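(* On the cohomogeneity one manifold $M=S^4\times S^3$ with group diagram $\mathrm{SU}(2)^2\supset\Delta\mathrm{SU}(2),\Delta\mathrm{SU}(2)\supset\{1\}$, there are no $\mathrm{SU}(2)^2$-invariant coclosed $G_2$-structures constructed from half-flat $\mathrm{SU}(3)$-structures.
   Context: A $G_2$-structure on a 7-manifold is a smooth positive 3-form $\varphi$ (pointwise linearly equivalent to $e^{123}-e^{167}-e^{527}-e^{563}-e^{415}-e^{426}-e^{437}$ on $\mathbb{R}^7$); it induces a metric $g_\varphi$, an orientation and a Hodge star $*_\varphi$. It is coclosed if $d{*_\varphi}\varphi=0$. The manifold: $M=S^3\times S^4\subset\mathbb{H}\times(\mathbb{H}\times\mathbb{R})$, with $G=\mathrm{SU}(2)^2$ (unit quaternions) acting by $(a_1,a_2)\cdot(p,q,s)=(a_1pa_2^{-1},a_2q,s)$. There are two singular orbits, both diffeomorphic to $\mathrm{SU}(2)^2/\Delta\mathrm{SU}(2)\cong S^3$ (where $\Delta\mathrm{SU}(2)$ is the diagonal), and the principal isotropy group is trivial. Given an invariant metric, let $\gamma:[0,1]\to M$ be a normal geodesic (orthogonal to all principal orbits) parametrised by arc length, joining the two singular orbits (the length is normalised to 1), with isotropy groups $\Delta\mathrm{SU}(2)$ at both $\gamma(0)$ and $\gamma(1)$ and trivial isotropy at $\gamma(t)$, $0<t<1$. The principal part of $M$ (the complement of the singular orbits) is identified with $(0,1)\times G$ via $(t,g)\mapsto g\cdot\gamma(t)$. Let $T_1,T_2,T_3$ be a basis of $\mathfrak{su}(2)$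 with $[T_i,T_j]=2\epsilon_{ijk}T_k$, let $T_i^{\pm}=(T_i,\pm T_i)\in\mathfrak{su}(2)\oplus\mathfrak{su}(2)$, and let $\eta_i^{\pm}$ be the left-invariant 1-forms on $G$ forming the dual basis of $\{T_i^+,T_i^-\}$. For functions $A_i,B_i$ ($i=1,2,3$) of $t$, nowhere zero on $(0,1)$, set $$\omega=4\sum_{i}A_iB_i\,\eta_i^-\wedge\eta_i^+,\qquad \Omega_1=8B_1B_2B_3\,\eta_1^-\wedge\eta_2^-\wedge\eta_3^- -4\sum_{i,j,k}\epsilon_{ijk}A_iA_jB_k\,\eta_i^+\wedge\eta_j^+\wedge\eta_k^-,$$ $$\Omega_2=-8A_1A_2A_3\,\eta_1^+\wedge\eta_2^+\wedge\eta_3^+ +4\sum_{i,j,k}\epsilon_{ijk}B_iB_jA_k\,\eta_i^-\wedge\eta_j^-\wedge\eta_k^+,$$ and $$\varphi_{A,B}=dt\wedge\omega+\Omega_1,\qquad {*_\varphi}\varphi_{A,B}=\tfrac12\omega^2-dt\wedge\Omega_2 .$$ For each $t$ the triple $(\omega,\Omega_1,\Omega_2)$ is a half-flat $\mathrm{SU}(3)$-structure on $\{t\}\times G$ (i.e. $d\Omega_1=0$ and $d\omega^2=0$ there), and $\varphi_{A,B}$ induces the metric $dt^2+\sum_i(2A_i)^2\eta_i^+\otimes\eta_i^++\sum_i(2B_i)^2\eta_i^-\otimes\eta_i^-$. An $\mathrm{SU}(2)^2$-invariant $G_2$-structure on $M$ is said to be constructed from a half-flat $\mathrm{SU}(3)$-structure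 if its restriction to the principal part $(0,1)\times G$ is of the form $\varphi_{A,B}$ for some functions $A_i,B_i$ of $t$, nowhere zero on $(0,1)$. *)

theory Defs
  imports "HOL-Analysis.Analysis"
begin

section \<open>Quaternions, the group and the manifold\<close>

text \<open>A quaternion is a pair (real part, imaginary part).\<close>

type_synonym quat = "real \<times> (real^3)"

definition qmult :: "quat \<Rightarrow> quat \<Rightarrow> quat" where
  "qmult x y = (fst x * fst y - snd x \<bullet> snd y,
                fst x *\<^sub>R snd y + fst y *\<^sub>R snd x + cross3 (snd x) (snd y))"

definition qconj :: "quat \<Rightarrow> quat" where
  "qconj x = (fst x, - snd x)"

definition qone :: quat where
  "qone = (1, 0)"

definition SU2 :: "quat set" where
  "SU2 = sphere 0 1"

definition su2 :: "quat set" where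
  "su2 = {x. fst x = 0}"

definition lie_bracket :: "quat \<Rightarrow> quat \<Rightarrow> quat" where
  "lie_bracket x y = qmult x y - qmult y x"

type_synonym pt = "quat \<times> (quat \<times> real)"

definition S3xS4 :: "pt set" where
  "S3xS4 = Sigma (sphere 0 1) (\<lambda>_. sphere 0 1)"

text \<open>Kernel of the differential of the two equations
  \<open>norm (fst x) = 1\<close>, \<open>norm (snd x) = 1\<close>.\<close>

definition tan_S3xS4 :: "pt \<Rightarrow> pt set" where
  "tan_S3xS4 x = {v. fst x \<bullet> fst v = 0 \<and> snd x \<bullet> snd v = 0}"

definition G :: "(quat \<times> quat) set" where
  "G = Sigma SU2 (\<lambda>_. SU2)"

definition tan_G :: "quat \<times> quat \<Rightarrow> (quat \<times> quat) set" where
  "tan_G a = {u. fst a \<bullet> fst u = 0 \<and> snd a \<bullet> snd u = 0}"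

text \<open>On \<open>G\<close> the inverse is the conjugate; written so, the action extends to a polynomial map.\<close>

definition act :: "quat \<times> quat \<Rightarrow> pt \<Rightarrow> pt" where
  "act a x = (qmult (qmult (fst a) (fst x)) (qconj (snd a)),
              (qmult (snd a) (fst (snd x)), snd (snd x)))"

definition orbit :: "pt \<Rightarrow> pt set" where
  "orbit x = (\<lambda>a. act a x) ` G"

definition isotropy :: "pt \<Rightarrow> (quat \<times> quat) set" where
  "isotropy x = {a \<in> G. act a x = x}"

definition Delta_SU2 :: "(quat \<times> quat) set" where
  "Delta_SU2 = {(a, a) |a. a \<in> SU2}"

definition tan_orbit :: "pt \<Rightarrow> pt set" where
  "tan_orbit x = frechet_derivative (\<lambda>a. act a x) (at (qone, qone)) ` Sigma su2 (\<lambda>_. su2)"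

section \<open>Smooth maps and differential forms\<close>

primrec k_times_differentiable_on ::
    "nat \<Rightarrow> 'a::euclidean_space set \<Rightarrow> ('a \<Rightarrow> 'b::real_normed_vector) \<Rightarrow> bool" where
  "k_times_differentiable_on 0 U = (\<lambda>f. continuous_on U f)"
| "k_times_differentiable_on (Suc k) U =
     (\<lambda>f. \<exists>f'. (\<forall>x\<in>U. (f has_derivative f' x) (at x)) \<and>
               (\<forall>v. k_times_differentiable_on k U (\<lambda>x. f' x v)))"

text \<open>To be used for open sets only.\<close>

definition smooth_on :: "'a::euclidean_space set \<Rightarrow> ('a \<Rightarrow> 'b::real_normed_vector) \<Rightarrow> bool" where
  "smooth_on U f \<longleftrightarrow> (\<forall>k. k_times_differentiable_on k U f)"

text \<open>A \<open>k\<close>-form eats a sequence of vectors, of which only the entries \<open>0, \<dots>, k - 1\<close> matter.\<close>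

type_synonym 'v form = "(nat \<Rightarrow> 'v) \<Rightarrow> real"

definition alt_form :: "nat \<Rightarrow> 'v::real_vector form \<Rightarrow> bool" where
  "alt_form k \<alpha> \<longleftrightarrow>
     (\<forall>v w. (\<forall>i<k. v i = w i) \<longrightarrow> \<alpha> v = \<alpha> w) \<and>
     (\<forall>v. \<forall>i<k. linear (\<lambda>u. \<alpha> (v(i := u)))) \<and>
     (\<forall>v. \<forall>i<k. \<forall>j<k. i \<noteq> j \<and> v i = v j \<longrightarrow> \<alpha> v = 0)"

text \<open>Normalised such that \<open>(\<alpha> \<and> \<beta>)(u, v) = \<alpha> u * \<beta> v - \<alpha> v * \<beta> u\<close> for 1-forms.\<close>

definition wedge :: "nat \<Rightarrow> nat \<Rightarrow> 'v form \<Rightarrow> 'v form \<Rightarrow> 'v form" where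
  "wedge p q \<alpha> \<beta> v =
     (\<Sum>\<sigma> | \<sigma> permutes {..<p + q}.
        of_int (sign \<sigma>) * \<alpha> (\<lambda>i. v (\<sigma> i)) * \<beta> (\<lambda>i. v (\<sigma> (p + i)))) / (fact p * fact q)"

definition wedge3 :: "'v form \<Rightarrow> 'v form \<Rightarrow> 'v form \<Rightarrow> 'v form" where
  "wedge3 \<alpha> \<beta> \<gamma> = wedge 2 1 (wedge 1 1 \<alpha> \<beta>) \<gamma>"

text \<open>Exterior derivative of a \<open>k\<close>-form field on an open subset of a Euclidean space.\<close>

definition ext_deriv ::
    "nat \<Rightarrow> ('v::euclidean_space \<Rightarrow> 'v form) \<Rightarrow> 'v \<Rightarrow> 'v form" where
  "ext_deriv k \<Psi> x v =
     (\<Sum>i\<le>k. (- 1) ^ i *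
        frechet_derivative (\<lambda>y. \<Psi> y (\<lambda>j. if j < i then v j else v (Suc j))) (at x) (v i))"

text \<open>A \<open>k\<close>-form on the submanifold \<open>S3xS4\<close> is given by a function \<open>\<alpha>\<close> of which only the values
  \<open>\<alpha> x v\<close> with \<open>x\<close> in the manifold and \<open>v 0, \<dots>, v (k - 1)\<close> tangent at \<open>x\<close> are relevant.
  It is smooth if it is the restriction of a smooth form on an open neighbourhood, and since
  restriction to a submanifold commutes with \<open>d\<close>, its exterior derivative is the restriction of
  that of any such extension.\<close>

definition extends_form ::
    "nat \<Rightarrow> (pt \<Rightarrow> pt form) \<Rightarrow> pt set \<Rightarrow> (pt \<Rightarrow> pt form) \<Rightarrow> bool" where
  "extends_form k \<alpha> U \<Psi> \<longleftrightarrow>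
     open U \<and> S3xS4 \<subseteq> U \<and> (\<forall>x\<in>U. alt_form k (\<Psi> x)) \<and> (\<forall>v. smooth_on U (\<lambda>x. \<Psi> x v)) \<and>
     (\<forall>x\<in>S3xS4. \<forall>v. (\<forall>i<k. v i \<in> tan_S3xS4 x) \<longrightarrow> \<alpha> x v = \<Psi> x v)"

definition smooth_form :: "nat \<Rightarrow> (pt \<Rightarrow> pt form) \<Rightarrow> bool" where
  "smooth_form k \<alpha> \<longleftrightarrow> (\<exists>U \<Psi>. extends_form k \<alpha> U \<Psi>)"

definition closed_form :: "nat \<Rightarrow> (pt \<Rightarrow> pt form) \<Rightarrow> bool" where
  "closed_form k \<alpha> \<longleftrightarrow>
     (\<exists>U \<Psi>. extends_form k \<alpha> U \<Psi> \<and>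
       (\<forall>x\<in>S3xS4. \<forall>v. (\<forall>i\<le>k. v i \<in> tan_S3xS4 x) \<longrightarrow> ext_deriv k \<Psi> x v = 0))"

text \<open>Each \<open>act a\<close> is a linear map and hence its own differential.\<close>

definition invariant_form :: "nat \<Rightarrow> (pt \<Rightarrow> pt form) \<Rightarrow> bool" where
  "invariant_form k \<alpha> \<longleftrightarrow>
     (\<forall>a\<in>G. \<forall>x\<in>S3xS4. \<forall>v. (\<forall>i<k. v i \<in> tan_S3xS4 x) \<longrightarrow>
        \<alpha> (act a x) (\<lambda>i. act a (v i)) = \<alpha> x v)"

definition pullback ::
    "('w::real_normed_vector \<Rightarrow> 'v::real_normed_vector) \<Rightarrow> ('v \<Rightarrow> 'v form) \<Rightarrow> 'w \<Rightarrow> 'w form" where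
  "pullback F \<alpha> x v = \<alpha> (F x) (\<lambda>i. frechet_derivative F (at x) (v i))"

section \<open>$G_2$-structures\<close>

text \<open>The covectors \<open>e\<^sup>1, \<dots>, e\<^sup>7\<close> (in the type \<open>7\<close>, the index \<open>7\<close> is \<open>0\<close>).\<close>

definition e1form :: "7 \<Rightarrow> (real^7) form" where
  "e1form i v = v 0 $ i"

definition e3form :: "7 \<Rightarrow> 7 \<Rightarrow> 7 \<Rightarrow> (real^7) form" where
  "e3form i j k = wedge3 (e1form i) (e1form j) (e1form k)"

definition phi0 :: "(real^7) form" where
  "phi0 v = e3form 1 2 3 v - e3form 1 6 7 v - e3form 5 2 7 v - e3form 5 6 3 v
            - e3form 4 1 5 v - e3form 4 2 6 v - e3form 4 3 7 v"

text \<open>The orientation of \<open>\<real>\<^sup>7\<close> induced by \<open>phi0\<close> (for which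
  \<open>(u \<lrcorner> phi0) \<and> (u \<lrcorner> phi0) \<and> phi0\<close> is positive for \<open>u \<noteq> 0\<close>, and for which the dual of
  \<open>dt \<and> \<omega> + \<Omega>\<^sub>1\<close> is \<open>\<omega>\<^sup>2 / 2 - dt \<and> \<Omega>\<^sub>2\<close>) is the opposite of the standard one:
  the volume form is \<open>- e\<^sup>1 \<and> \<dots> \<and> e\<^sup>7\<close>.\<close>

definition vol0 :: "(real^7) form" where
  "vol0 v = - (\<Sum>\<sigma> | \<sigma> permutes {..<7}.
                 of_int (sign \<sigma>) * (\<Prod>i<7. v i $ of_nat (Suc (\<sigma> i))))"

text \<open>Hodge star on \<open>p\<close>-forms of \<open>\<real>\<^sup>7\<close> for the Euclidean metric and \<open>vol0\<close>:
  \<open>(* \<alpha>)(v) = 1/p! \<Sum> \<alpha>(e\<^sub>f\<^sub>1, \<dots>, e\<^sub>f\<^sub>p) vol0(e\<^sub>f\<^sub>1, \<dots>, e\<^sub>f\<^sub>p, v)\<close>.\<close>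

definition hodge0 :: "nat \<Rightarrow> (real^7) form \<Rightarrow> (real^7) form" where
  "hodge0 p \<alpha> v =
     (\<Sum>f \<in> {..<p} \<rightarrow>\<^sub>E (UNIV :: 7 set).
        \<alpha> (\<lambda>i. axis (f i) 1) *
        vol0 (\<lambda>i. if i < p then axis (f i) 1 else v (i - p))) / fact p"

definition adapted :: "(pt \<Rightarrow> pt form) \<Rightarrow> pt \<Rightarrow> (real^7 \<Rightarrow> pt) \<Rightarrow> bool" where
  "adapted \<phi> x L \<longleftrightarrow>
     linear L \<and> inj L \<and> range L = tan_S3xS4 x \<and> (\<forall>v. \<phi> x (\<lambda>i. L (v i)) = phi0 v)"

definition G2_structure :: "(pt \<Rightarrow> pt form) \<Rightarrow> bool" where
  "G2_structure \<phi> \<longleftrightarrow> smooth_form 3 \<phi> \<and> (\<forall>x\<in>S3xS4. \<exists>L. adapted \<phi> x L)"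

text \<open>The metric and the Hodge star induced by \<open>\<phi>\<close> are transported from \<open>\<real>\<^sup>7\<close> by adapted
  isomorphisms. Two of these differ by an element of the stabiliser of \<open>phi0\<close>, which is contained
  in \<open>SO(7)\<close>, so all of them give the same result. \<open>induced_metric \<phi> U g\<close>: on tangent vectors
  of the manifold \<open>g\<close> is the induced metric, extended to smoothly varying bilinear forms
  on an open neighbourhood \<open>U\<close>.\<close>

definition induced_metric ::
    "(pt \<Rightarrow> pt form) \<Rightarrow> pt set \<Rightarrow> (pt \<Rightarrow> pt \<Rightarrow> pt \<Rightarrow> real) \<Rightarrow> bool" where
  "induced_metric \<phi> U g \<longleftrightarrow>
     open U \<and> S3xS4 \<subseteq> U \<and> (\<forall>x\<in>U. bilinear (g x)) \<and> (\<forall>u v. smooth_on U (\<lambda>x. g x u v)) \<and>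
     (\<forall>x\<in>S3xS4. \<forall>L. adapted \<phi> x L \<longrightarrow> (\<forall>a b. g x (L a) (L b) = a \<bullet> b))"

definition is_hodge_star ::
    "(pt \<Rightarrow> pt form) \<Rightarrow> nat \<Rightarrow> (pt \<Rightarrow> pt form) \<Rightarrow> (pt \<Rightarrow> pt form) \<Rightarrow> bool" where
  "is_hodge_star \<phi> p \<alpha> \<beta> \<longleftrightarrow>
     (\<forall>x\<in>S3xS4. \<forall>L. adapted \<phi> x L \<longrightarrow>
        (\<forall>v. \<beta> x (\<lambda>i. L (v i)) = hodge0 p (\<lambda>w. \<alpha> x (\<lambda>i. L (w i))) v))"

definition coclosed :: "(pt \<Rightarrow> pt form) \<Rightarrow> bool" where
  "coclosed \<phi> \<longleftrightarrow> (\<exists>\<psi>. is_hodge_star \<phi> 3 \<phi> \<psi> \<and> closed_form 4 \<psi>)"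

section \<open>Normal geodesics\<close>

text \<open>The geodesic equation with lowered index,
  \<open>d/dt (g\<^sub>k\<^sub>j x'\<^sup>j) = 1/2 (\<partial>\<^sub>k g\<^sub>i\<^sub>j) x'\<^sup>i x'\<^sup>j\<close>, is the Euler-Lagrange equation of the energy. For a
  curve in a submanifold it is the same equation in the ambient coordinates, paired with the
  tangent vectors \<open>w\<close> only; it then depends only on the restriction of \<open>g\<close> to the submanifold.\<close>

definition geodesic :: "(pt \<Rightarrow> pt \<Rightarrow> pt \<Rightarrow> real) \<Rightarrow> (real \<Rightarrow> pt) \<Rightarrow> bool" where
  "geodesic g \<gamma> \<longleftrightarrow>
     (\<exists>I. open I \<and> {0..1} \<subseteq> I \<and> smooth_on I \<gamma>) \<and> \<gamma> ` {0..1} \<subseteq> S3xS4 \<and>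
     (let \<gamma>' = \<lambda>t. vector_derivative \<gamma> (at t) in
       \<forall>t\<in>{0..1}. \<forall>w\<in>tan_S3xS4 (\<gamma> t).
         ((\<lambda>s. g (\<gamma> s) (\<gamma>' s) w) has_real_derivative
            1/2 * frechet_derivative (\<lambda>y. g y (\<gamma>' t) (\<gamma>' t)) (at (\<gamma> t)) w) (at t within {0..1}))"

definition normal_geodesic :: "(pt \<Rightarrow> pt \<Rightarrow> pt \<Rightarrow> real) \<Rightarrow> (real \<Rightarrow> pt) \<Rightarrow> bool" where
  "normal_geodesic g \<gamma> \<longleftrightarrow>
     geodesic g \<gamma> \<and>
     (let \<gamma>' = \<lambda>t. vector_derivative \<gamma> (at t) in
       (\<forall>t\<in>{0..1}. g (\<gamma> t) (\<gamma>' t) (\<gamma>' t) = 1) \<and>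
       (\<forall>t\<in>{0<..<1}. \<forall>w\<in>tan_orbit (\<gamma> t). g (\<gamma> t) (\<gamma>' t) w = 0)) \<and>
     isotropy (\<gamma> 0) = Delta_SU2 \<and> isotropy (\<gamma> 1) = Delta_SU2 \<and> orbit (\<gamma> 0) \<noteq> orbit (\<gamma> 1) \<and>
     (\<forall>t\<in>{0<..<1}. isotropy (\<gamma> t) = {(qone, qone)})"

section \<open>The forms constructed from half-flat SU(3)-structures\<close>

text \<open>Indices run over \<open>{1..3}\<close>.\<close>

definition eps3 :: "nat \<Rightarrow> nat \<Rightarrow> nat \<Rightarrow> real" where
  "eps3 i j k = sgn ((real j - real i) * (real k - real i) * (real k - real j))"

definition su2_basis :: "(nat \<Rightarrow> quat) \<Rightarrow> bool" where
  "su2_basis T \<longleftrightarrow>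
     inj_on T {1..3} \<and> independent (T ` {1..3}) \<and> span (T ` {1..3}) = su2 \<and>
     (\<forall>i\<in>{1..3}. \<forall>j\<in>{1..3}. lie_bracket (T i) (T j) = (\<Sum>k\<in>{1..3}. (2 * eps3 i j k) *\<^sub>R T k))"

definition T_plus :: "(nat \<Rightarrow> quat) \<Rightarrow> nat \<Rightarrow> quat \<times> quat" where
  "T_plus T i = (T i, T i)"

definition T_minus :: "(nat \<Rightarrow> quat) \<Rightarrow> nat \<Rightarrow> quat \<times> quat" where
  "T_minus T i = (T i, - T i)"

definition T_basis :: "(nat \<Rightarrow> quat) \<Rightarrow> (quat \<times> quat) set" where
  "T_basis T = T_plus T ` {1..3} \<union> T_minus T ` {1..3}"

text \<open>For \<open>u\<close> tangent to \<open>G\<close> at \<open>a\<close>, the left translate of \<open>u\<close> to the Lie algebra.\<close>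

definition maurer_cartan :: "quat \<times> quat \<Rightarrow> quat \<times> quat \<Rightarrow> quat \<times> quat" where
  "maurer_cartan a u = (qmult (qconj (fst a)) (fst u), qmult (qconj (snd a)) (snd u))"

text \<open>Forms on \<open>(0,1) \<times> G\<close>, at the point \<open>z = (t, a)\<close>; tangent vectors are pairs \<open>(\<tau>, u)\<close> with
  \<open>u\<close> tangent to \<open>G\<close> at \<open>a\<close>.\<close>

type_synonym cyl = "real \<times> (quat \<times> quat)"

definition eta_plus :: "(nat \<Rightarrow> quat) \<Rightarrow> nat \<Rightarrow> cyl \<Rightarrow> cyl form" where
  "eta_plus T i z v =
     representation (T_basis T) (maurer_cartan (snd z) (snd (v 0))) (T_plus T i)"

definition eta_minus :: "(nat \<Rightarrow> quat) \<Rightarrow> nat \<Rightarrow> cyl \<Rightarrow> cyl form" where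
  "eta_minus T i z v =
     representation (T_basis T) (maurer_cartan (snd z) (snd (v 0))) (T_minus T i)"

definition dt_form :: "cyl form" where
  "dt_form v = fst (v 0)"

definition omega_AB ::
    "(nat \<Rightarrow> quat) \<Rightarrow> (nat \<Rightarrow> real \<Rightarrow> real) \<Rightarrow> (nat \<Rightarrow> real \<Rightarrow> real) \<Rightarrow> cyl \<Rightarrow> cyl form" where
  "omega_AB T A B z v =
     4 * (\<Sum>i\<in>{1..3}. A i (fst z) * B i (fst z) * wedge 1 1 (eta_minus T i z) (eta_plus T i z) v)"

definition Omega1_AB ::
    "(nat \<Rightarrow> quat) \<Rightarrow> (nat \<Rightarrow> real \<Rightarrow> real) \<Rightarrow> (nat \<Rightarrow> real \<Rightarrow> real) \<Rightarrow> cyl \<Rightarrow> cyl form" where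
  "Omega1_AB T A B z v =
     8 * B 1 (fst z) * B 2 (fst z) * B 3 (fst z) *
       wedge3 (eta_minus T 1 z) (eta_minus T 2 z) (eta_minus T 3 z) v
     - 4 * (\<Sum>i\<in>{1..3}. \<Sum>j\<in>{1..3}. \<Sum>k\<in>{1..3}.
         eps3 i j k * A i (fst z) * A j (fst z) * B k (fst z) *
         wedge3 (eta_plus T i z) (eta_plus T j z) (eta_minus T k z) v)"

definition phi_AB ::
    "(nat \<Rightarrow> quat) \<Rightarrow> (nat \<Rightarrow> real \<Rightarrow> real) \<Rightarrow> (nat \<Rightarrow> real \<Rightarrow> real) \<Rightarrow> cyl \<Rightarrow> cyl form" where
  "phi_AB T A B z v = wedge 1 2 dt_form (omega_AB T A B z) v + Omega1_AB T A B z v"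

definition constructed_from_half_flat :: "(nat \<Rightarrow> quat) \<Rightarrow> (pt \<Rightarrow> pt form) \<Rightarrow> bool" where
  "constructed_from_half_flat T \<phi> \<longleftrightarrow>
     (\<exists>U g \<gamma> A B. induced_metric \<phi> U g \<and> normal_geodesic g \<gamma> \<and>
        (\<forall>i\<in>{1..3}. \<forall>t\<in>{0<..<1}. A i t \<noteq> 0 \<and> B i t \<noteq> 0) \<and>
        (\<forall>t\<in>{0<..<1}. \<forall>a\<in>G. \<forall>v. (\<forall>i<3. snd (v i) \<in> tan_G a) \<longrightarrow>
           pullback (\<lambda>(s, b). act b (\<gamma> s)) \<phi> (t, a) v = phi_AB T A B (t, a) v))"

end

theory Submission
  imports Defs
begin

text \<open>Write \<open>\<psi>\<close> for the Hodge dual of \<open>\<phi>\<close>. For cyclic \<open>(i, j, k)\<close> let \<open>f\<^sub>k(t)\<close> be the value of \<open>\<psi>\<close> at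
  \<open>\<gamma>(t)\<close> on the fundamental vector fields of \<open>T\<^sub>i\<^sup>-\<close>, \<open>T\<^sub>j\<^sup>-\<close>, \<open>T\<^sub>i\<^sup>+\<close>, \<open>T\<^sub>j\<^sup>+\<close>. It equals
  \<open>-16 A\<^sub>i B\<^sub>i A\<^sub>j B\<^sub>j\<close> for \<open>0 < t < 1\<close>. Invariance and closedness of \<open>\<psi>\<close> express \<open>f\<^sub>k'\<close> through Lie
  brackets,
  \<open>f\<^sub>k' = -16 (A\<^sub>1 A\<^sub>2 A\<^sub>3 + A\<^sub>i B\<^sub>j B\<^sub>k + A\<^sub>j B\<^sub>k B\<^sub>i - A\<^sub>k B\<^sub>i B\<^sub>j)\<close>.
  Each \<open>f\<^sub>k\<close> vanishes at both ends, because the fields of the \<open>T\<^sub>i\<^sup>+\<close> vanish on the singular orbits,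
  and has a constant sign \<open>s\<^sub>k\<close> in between. By Rolle, \<open>\<Sum> s\<^sub>k f\<^sub>k\<close> has a critical point; but whatever the
  signs of the \<open>A\<^sub>i\<close> and \<open>B\<^sub>i\<close> are, all the terms of \<open>A\<^sub>1 A\<^sub>2 A\<^sub>3 \<Sum> s\<^sub>k f\<^sub>k'\<close> that survive cancellation
  have the same sign.\<close>

section \<open>Quaternions and the action\<close>

lemma qmult_bounded_bilinear: "bounded_bilinear qmult"
proof -
  have "bilinear qmult"
    unfolding bilinear_def linear_iff qmult_def
    by (simp add: prod_eq_iff vec_eq_iff forall_3 cross3_def inner_vec_def sum_3 algebra_simps)
  then show ?thesis
    by (simp add: bilinear_conv_bounded_bilinear)
qed

interpretation qmult: bounded_bilinear qmult
  by (rule qmult_bounded_bilinear)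

lemma qmult_assoc: "qmult (qmult x y) z = qmult x (qmult y z)"
  unfolding qmult_def
  by (simp add: prod_eq_iff vec_eq_iff forall_3 cross3_def inner_vec_def sum_3 algebra_simps)

lemma qmult_one [simp]: "qmult qone x = x" "qmult x qone = x"
  by (simp_all add: qmult_def qone_def prod_eq_iff cross3_def vec_eq_iff forall_3)

lemma qconj_qmult: "qconj (qmult x y) = qmult (qconj y) (qconj x)"
  unfolding qmult_def qconj_def
  by (simp add: prod_eq_iff vec_eq_iff forall_3 cross3_def inner_vec_def sum_3 algebra_simps)

lemma qconj_linear: "bounded_linear qconj"
  unfolding qconj_def
  by (intro bounded_linear_Pair bounded_linear_fst bounded_linear_minus bounded_linear_snd)

lemma qconj_simps:
  "qconj (x + y) = qconj x + qconj y" "qconj (x - y) = qconj x - qconj y" "qconj (c *\<^sub>R x) = c *\<^sub>R qconj x"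
  by (simp_all add: qconj_def)

lemma qconj_qconj [simp]: "qconj (qconj x) = x"
  by (simp add: qconj_def)

lemma qconj_qone [simp]: "qconj qone = qone"
  by (simp add: qconj_def qone_def)

text \<open>This is the multiplicativity of the quaternion norm, polarised. Through it
  \<open>act a\<close> with \<open>a\<close> in \<open>G\<close> preserves inner products on both
  sphere factors.\<close>

lemma inner_qmult: "qmult a x \<bullet> qmult a y = (a \<bullet> a) * (x \<bullet> y)"
    "qmult x a \<bullet> qmult y a = (a \<bullet> a) * (x \<bullet> y)"
  unfolding qmult_def inner_prod_def
  by (simp_all add: cross3_def inner_vec_def sum_3 algebra_simps)

lemma inner_qconj [simp]: "qconj x \<bullet> qconj y = x \<bullet> y"
  by (simp add: qconj_def inner_prod_def)

lemma qmult_qconj: "qmult (qconj a) a = (a \<bullet> a) *\<^sub>R qone" "qmult a (qconj a) = (a \<bullet> a) *\<^sub>R qone"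
  unfolding qmult_def qconj_def qone_def inner_prod_def
  by (simp_all add: prod_eq_iff vec_eq_iff forall_3 cross3_def inner_vec_def sum_3 algebra_simps)

section \<open>The group, the manifold and the action\<close>

lemma SU2_iff: "a \<in> SU2 \<longleftrightarrow> a \<bullet> a = 1"
  by (simp add: SU2_def norm_eq_1)

lemma G_iff: "a \<in> G \<longleftrightarrow> fst a \<bullet> fst a = 1 \<and> snd a \<bullet> snd a = 1"
  by (cases a) (simp add: G_def SU2_iff)

lemma S3xS4_iff: "x \<in> S3xS4 \<longleftrightarrow> fst x \<bullet> fst x = 1 \<and> snd x \<bullet> snd x = 1"
  by (cases x) (simp add: S3xS4_def norm_eq_1)

lemma act_linear: "linear (act a)"
  unfolding act_def linear_iff
  by (simp add: qmult.add_left qmult.add_right qmult.scaleR_left qmult.scaleR_right)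

lemma inner_Pair_eq: "(a, b) \<bullet> x = a \<bullet> fst x + b \<bullet> snd x" "x \<bullet> (a, b) = fst x \<bullet> a + snd x \<bullet> b"
  by (simp_all add: inner_prod_def)

lemma act_inner:
  assumes "a \<in> G"
  shows "fst (act a x) \<bullet> fst (act a y) = fst x \<bullet> fst y"
    and "snd (act a x) \<bullet> snd (act a y) = snd x \<bullet> snd y"
  using assms by (simp_all add: act_def inner_qmult G_iff inner_Pair_eq inner_prod_def[of "snd _"])

lemma act_S3xS4: "a \<in> G \<Longrightarrow> x \<in> S3xS4 \<Longrightarrow> act a x \<in> S3xS4"
  by (simp add: S3xS4_iff act_inner)

lemma act_tan: "a \<in> G \<Longrightarrow> v \<in> tan_S3xS4 x \<Longrightarrow> act a v \<in> tan_S3xS4 (act a x)"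
  by (simp add: tan_S3xS4_def act_inner)

text \<open>Conjugation inverts unit quaternions, so on \<open>G\<close> this is the group
  inverse.\<close>

definition ginv :: "quat \<times> quat \<Rightarrow> quat \<times> quat" where
  "ginv a = (qconj (fst a), qconj (snd a))"

lemma ginv_G: "a \<in> G \<Longrightarrow> ginv a \<in> G"
  by (simp add: ginv_def G_iff)

lemma ginv_ginv [simp]: "ginv (ginv a) = a"
  by (simp add: ginv_def)

lemma act_ginv: "a \<in> G \<Longrightarrow> act (ginv a) (act a x) = x"
proof -
  assume "a \<in> G"
  then have 1: "qmult (qconj (fst a)) (fst a) = qone" "qmult (qconj (snd a)) (snd a) = qone"
    by (simp_all add: qmult_qconj G_iff)
  have "qmult (qconj (fst a)) (qmult (qmult (fst a) y) z) = qmult y z"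
       "qmult (qconj (snd a)) (qmult (snd a) y) = y" for y z
    by (simp_all add: 1 flip: qmult_assoc)
  then show ?thesis
    by (simp add: act_def ginv_def qmult_assoc 1)
qed

lemma act_image_tan:
  assumes "a \<in> G"
  shows "act a ` tan_S3xS4 x = tan_S3xS4 (act a x)"
proof
  show "act a ` tan_S3xS4 x \<subseteq> tan_S3xS4 (act a x)"
    using assms act_tan by blast
  show "tan_S3xS4 (act a x) \<subseteq> act a ` tan_S3xS4 x"
  proof
    fix v assume v: "v \<in> tan_S3xS4 (act a x)"
    have "act (ginv a) v \<in> tan_S3xS4 x"
      using act_tan[OF ginv_G[OF assms] v] act_ginv[OF assms] by simp
    moreover have "act a (act (ginv a) v) = v"
      using act_ginv[OF ginv_G[OF assms]] by simp
    ultimately show "v \<in> act a ` tan_S3xS4 x"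
      by (metis imageI)
  qed
qed

text \<open>On tangent vectors \<open>act a\<close> is a linear isomorphism that preserves \<phi>,
  so it carries adapted frames to adapted frames. Whatever is computed from \<phi> in adapted frames
  inherits the invariance.\<close>

lemma adapted_act:
  assumes \<phi>: "invariant_form 3 \<phi>" and a: "a \<in> G" and x: "x \<in> S3xS4" and L: "adapted \<phi> x L"
  shows "adapted \<phi> (act a x) (\<lambda>v. act a (L v))"
proof -
  have lin: "linear L" and inj: "inj L" and ran: "range L = tan_S3xS4 x"
    and eq: "\<And>v. \<phi> x (\<lambda>i. L (v i)) = phi0 v"
    using L by (auto simp: adapted_def)
  have "inj (act a)"
    by (metis a act_ginv injI)
  then have "inj (act a \<circ> L)"
    using inj by (simp add: inj_compose)
  moreover have "linear (act a \<circ> L)"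
    using lin act_linear by (rule linear_compose)
  moreover have "range (act a \<circ> L) = tan_S3xS4 (act a x)"
    by (simp only: image_comp[symmetric] ran act_image_tan[OF a])
  moreover have "\<phi> (act a x) (\<lambda>i. act a (L (v i))) = phi0 v" for v
  proof -
    have "L (v i) \<in> tan_S3xS4 x" for i
      using ran by blast
    then show ?thesis
      using \<phi> a x eq unfolding invariant_form_def by metis
  qed
  ultimately show ?thesis
    by (simp add: adapted_def comp_def)
qed

text \<open>An adapted frame turns \<phi> into \<open>phi0\<close>, so the dual has the same
  components in every adapted frame, whatever the point.\<close>

lemma hodge_star_adapted:
  assumes "is_hodge_star \<phi> 3 \<phi> \<psi>" "x \<in> S3xS4" "adapted \<phi> x L"
  shows "\<psi> x (\<lambda>i. L (v i)) = hodge0 3 phi0 v"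
proof -
  have "(\<lambda>w. \<phi> x (\<lambda>i. L (w i))) = phi0"
    using assms(3) by (auto simp: adapted_def)
  then show ?thesis
    using assms unfolding is_hodge_star_def by metis
qed

text \<open>The frame \<open>L\<close> at \<open>x\<close> and the frame \<open>act a\<close> after
  \<open>L\<close> at \<open>act a x\<close> are both adapted, so \<psi> has the same components in
  both.\<close>

lemma hodge_star_invariant:
  assumes G2: "G2_structure \<phi>" and inv: "invariant_form 3 \<phi>" and star: "is_hodge_star \<phi> 3 \<phi> \<psi>"
  shows "\<forall>a\<in>G. \<forall>x\<in>S3xS4. \<forall>v. (\<forall>i. v i \<in> tan_S3xS4 x) \<longrightarrow> \<psi> (act a x) (\<lambda>i. act a (v i)) = \<psi> x v"
proof (intro ballI allI impI)
  fix a x and v :: "nat \<Rightarrow> pt"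
  assume a: "a \<in> G" and x: "x \<in> S3xS4" and v: "\<forall>i. v i \<in> tan_S3xS4 x"
  obtain L where L: "adapted \<phi> x L"
    using G2 x unfolding G2_structure_def by blast
  \<comment> \<open>Every entry of \<open>v\<close>, not just the first four, must lie in the range
    of \<open>L\<close>: \<open>is_hodge_star\<close> only speaks about sequences of the form
    \<open>\<lambda>i. L (w i)\<close>. Hence the condition on all \<open>i\<close> in the
    statement.\<close>
  then have "\<exists>w. v i = L w" for i
    using v by (auto simp: adapted_def)
  then obtain w where w: "v = (\<lambda>i. L (w i))"
    by metis
  show "\<psi> (act a x) (\<lambda>i. act a (v i)) = \<psi> x v"
    unfolding w hodge_star_adapted[OF star x L]
    by (rule hodge_star_adapted[OF star act_S3xS4[OF a x] adapted_act[OF inv a x L]])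
qed

text \<open>The fundamental vector field of the Lie algebra element \<open>u\<close>. Like the action it is linear in the
  point, so it is its own differential.\<close>

definition fund_field :: "quat \<times> quat \<Rightarrow> pt \<Rightarrow> pt" where
  "fund_field u x = (qmult (fst u) (fst x) + qmult (fst x) (qconj (snd u)), qmult (snd u) (fst (snd x)), 0)"

section \<open>Linearity, commutators and tangency of the fundamental fields\<close>

lemma fund_field_linear: "linear (fund_field u)"
  unfolding fund_field_def linear_iff
  by (simp add: qmult.add_left qmult.add_right qmult.scaleR_left qmult.scaleR_right algebra_simps)

text \<open>Left and right multiplications commute, so the mixed terms cancel; \<open>qconj\<close>
  reverses products, which offsets the reversed order of the right multiplications. The left side is
  the commutator of linear maps; the Lie bracket of the vector fields has the opposite sign.\<close>

lemma fund_field_commutator: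
  "fund_field u (fund_field v x) - fund_field v (fund_field u x) =
     fund_field (lie_bracket (fst u) (fst v), lie_bracket (snd u) (snd v)) x"
  by (simp add: fund_field_def lie_bracket_def qconj_simps qconj_qmult qmult.diff_left qmult.diff_right
      qmult.add_left qmult.add_right qmult_assoc)

lemma fund_field_linear_left: "linear (\<lambda>u. fund_field u x)"
  unfolding fund_field_def linear_iff
  by (simp add: qconj_simps qmult.add_left qmult.add_right qmult.scaleR_left qmult.scaleR_right algebra_simps)

lemma su2_iff: "x \<in> su2 \<longleftrightarrow> qconj x = - x"
  by (auto simp: su2_def qconj_def prod_eq_iff)

text \<open>The product rule at the group identity, with the group element and the point both
  moving. It serves the one-parameter subgroups, where the point is fixed, and the map from the
  cylinder, where it runs along \<gamma>. Since \<open>fund_field\<close> keeps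
  \<open>qconj\<close>, directions outside the Lie algebra are covered as well.\<close>

lemma act_has_derivative:
  assumes b: "(b has_derivative b') (at s within S)" and x: "(x has_derivative x') (at s within S)"
    and 1: "b s = (qone, qone)"
  shows "((\<lambda>s. act (b s) (x s)) has_derivative (\<lambda>h. x' h + fund_field (b' h) (x s))) (at s within S)"
  unfolding act_def fund_field_def
  apply (rule has_derivative_eq_rhs)
   apply (rule derivative_intros b x qmult.FDERIV bounded_linear.has_derivative[OF qconj_linear])+
  apply (simp add: 1 prod_eq_iff fun_eq_iff)
  done

lemma fund_field_tan:
  assumes "fst u \<in> su2" "snd u \<in> su2"
  shows "fund_field u x \<in> tan_S3xS4 x"
proof -
  have "z \<bullet> qmult y z = 0" "z \<bullet> qmult z (qconj y) = 0" if "y \<in> su2" for y z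
    using that unfolding su2_def qmult_def inner_prod_def qconj_def
    by (simp_all add: cross3_def inner_vec_def sum_3 algebra_simps)
  with assms show ?thesis
    by (simp add: tan_S3xS4_def fund_field_def inner_add_right inner_prod_def[of "snd x"])
qed

text \<open>A point fixed by the diagonal has a vanishing second quaternion, and its first one
  commutes with all unit quaternions; the two parts of the field vanish accordingly.\<close>

lemma isotropy_Delta_fund_field:
  assumes iso: "isotropy x = Delta_SU2" and u: "u \<in> su2"
  shows "fund_field (u, u) x = 0"
proof -
  have fixed: "act (a, a) x = x" if "a \<in> SU2" for a
    using iso that unfolding isotropy_def Delta_SU2_def by blast
  \<comment> \<open>The diagonal element of -1 negates the second quaternion.\<close>
  have "qmult (- qone) (fst (snd x)) = fst (snd x)"
    using fixed[of "- qone"] by (simp add: act_def prod_eq_iff[of _ x] prod_eq_iff[of _ "snd x"] SU2_iff qone_def)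
  then have q: "fst (snd x) = 0"
    by (simp add: qmult.minus_left) (simp add: prod_eq_iff vec_eq_iff)
  have "qmult u (fst x) = qmult (fst x) u"
  proof (cases "u = 0")
    case True
    then show ?thesis by (simp add: qmult.zero_left qmult.zero_right)
  next
    case False
    \<comment> \<open>A unit imaginary quaternion itself belongs to \<open>SU2\<close>, so the
      isotropy condition applies to it directly, without exponentials or derivatives.\<close>
    define a where "a = (1 / norm u) *\<^sub>R u"
    have "a \<in> SU2"
      using False by (simp add: SU2_def a_def)
    then have "qmult (qmult a (fst x)) (qconj a) = fst x" and aa: "qmult (qconj a) a = qone"
      using fixed[of a] by (simp_all add: act_def prod_eq_iff[of _ x] qmult_qconj SU2_iff)
    then have "qmult a (fst x) = qmult (fst x) a"
      by (metis qmult_assoc qmult_one(2))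
    then show ?thesis
      using False by (simp add: a_def qmult.scaleR_left qmult.scaleR_right)
  qed
  with q u show ?thesis
    by (simp add: fund_field_def su2_iff qmult.zero_right qmult.minus_right) (simp add: zero_prod_def)
qed

section \<open>The forms on $\mathbb{R}^7$\<close>

lemma sum_permutes_2:
  "(\<Sum>\<sigma> | \<sigma> permutes {..<2::nat}. f \<sigma>) = f id + f (Transposition.transpose 0 1)"
proof -
  have *: "{..<2::nat} = insert 0 {1}" "finite {1::nat}" "(0::nat) \<notin> {1}"
    by auto
  show ?thesis
    unfolding *(1) sum_over_permutations_insert[OF *(2,3)] permutes_sing
    by simp
qed

lemma sum_permutes_3:
  "(\<Sum>\<sigma> | \<sigma> permutes {..<3::nat}. f \<sigma>) =
     f id + f (Transposition.transpose 0 1) + f (Transposition.transpose 0 2) + f (Transposition.transpose 1 2) +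
     f (Transposition.transpose 0 1 \<circ> Transposition.transpose 1 2) + f (Transposition.transpose 0 2 \<circ> Transposition.transpose 1 2)"
proof -
  have *: "{..<3::nat} = insert 0 {1,2}" "finite {1,2::nat}" "(0::nat) \<notin> {1,2}"
     "finite {2::nat}" "(1::nat) \<notin> {2}"
    by auto
  show ?thesis
    unfolding *(1) sum_over_permutations_insert[OF *(2,3)] sum_over_permutations_insert[OF *(4,5)] permutes_sing
    by (simp add: ac_simps)
qed

lemma sign_perm_3:
  "sign (Transposition.transpose 0 (1::nat) \<circ> Transposition.transpose 1 2) = 1" "sign (Transposition.transpose 0 (2::nat) \<circ> Transposition.transpose 1 2) = 1"
  by (simp_all add: sign_compose permutation_swap_id sign_swap_id)

lemma wedge_1_1:
  "wedge 1 1 (\<lambda>v. a (v 0)) (\<lambda>v. b (v 0)) v = a (v 0) * b (v 1) - a (v 1) * b (v 0)"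
  unfolding wedge_def one_add_one
  by (simp add: sum_permutes_2 sign_swap_id)

text \<open>The function \<alpha> need not be alternating here; hence the antisymmetrised
  differences and the remaining factor 1/2.\<close>

lemma wedge_2_1:
  "wedge 2 1 (\<lambda>v. \<alpha> (v 0) (v 1)) (\<lambda>v. b (v 0)) v =
    ((\<alpha> (v 0) (v 1) - \<alpha> (v 1) (v 0)) * b (v 2) + (\<alpha> (v 1) (v 2) - \<alpha> (v 2) (v 1)) * b (v 0)
     + (\<alpha> (v 2) (v 0) - \<alpha> (v 0) (v 2)) * b (v 1)) / 2"
proof -
  have 3: "2 + 1 = (3::nat)" by simp
  show ?thesis
    unfolding wedge_def 3 sum_permutes_3 sign_perm_3
    by (simp add: sign_swap_id transpose_def algebra_simps numeral_2_eq_2)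
qed

lemma wedge_1_2:
  "wedge 1 2 (\<lambda>v. b (v 0)) (\<lambda>v. \<alpha> (v 0) (v 1)) v =
    ((\<alpha> (v 0) (v 1) - \<alpha> (v 1) (v 0)) * b (v 2) + (\<alpha> (v 1) (v 2) - \<alpha> (v 2) (v 1)) * b (v 0)
     + (\<alpha> (v 2) (v 0) - \<alpha> (v 0) (v 2)) * b (v 1)) / 2"
proof -
  have 3: "1 + 2 = (3::nat)" by simp
  show ?thesis
    unfolding wedge_def 3 sum_permutes_3 sign_perm_3
    by (simp add: sign_swap_id transpose_def algebra_simps numeral_2_eq_2)
qed

text \<open>The 3 by 3 determinant of the three covectors on the three vectors, expanded along
  \<open>a\<close>.\<close>

lemma wedge3_1forms:
  "wedge3 (\<lambda>v. a (v 0)) (\<lambda>v. b (v 0)) (\<lambda>v. c (v 0)) v =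
     a (v 0) * (b (v 1) * c (v 2) - b (v 2) * c (v 1))
   - a (v 1) * (b (v 0) * c (v 2) - b (v 2) * c (v 0))
   + a (v 2) * (b (v 0) * c (v 1) - b (v 1) * c (v 0))"
  unfolding wedge3_def wedge_1_1[abs_def]
  using wedge_2_1[of "\<lambda>x y. a x * b y - a y * b x" c v]
  by (simp add: algebra_simps)

text \<open>Counting from 0: \<open>E n\<close> is the basis vector \<open>e\<^bsub>n+1\<^esub>\<close>, and \<open>e\<^sub>7\<close> has the index \<open>7 = 0\<close>.\<close>

abbreviation E :: "nat \<Rightarrow> real^7" where
  "E n \<equiv> axis (of_nat (Suc n)) 1"

section \<open>The volume form and the Hodge star on basis vectors\<close>

lemma of_nat_Suc_inj_7:
  assumes "i < 7" "j < 7"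
  shows "(of_nat (Suc i) :: 7) = of_nat (Suc j) \<longleftrightarrow> i = j"
proof -
  have "i \<in> {0,1,2,3,4,5,6}" "j \<in> {0,1,2,3,4,5,6}"
    using assms by auto
  then show ?thesis
    by (elim insertE emptyE) simp_all
qed

lemma range_of_nat_Suc_7: "of_nat ` Suc ` {..<7} = (UNIV :: 7 set)"
proof -
  have "inj_on (\<lambda>i. of_nat (Suc i) :: 7) {..<7}"
    using of_nat_Suc_inj_7 by (auto simp: inj_on_def)
  then have "card ((\<lambda>i. of_nat (Suc i) :: 7) ` {..<7}) = CARD(7)"
    by (simp add: card_image)
  then have "(\<lambda>i. of_nat (Suc i) :: 7) ` {..<7} = UNIV"
    by (simp add: card_subset_eq)
  then show ?thesis
    by (simp add: image_image)
qed

text \<open>On basis vectors each product in \<open>vol0\<close> is 0 or 1, and it is 1 exactly when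
  the permutation agrees with \<open>g\<close> on all seven indices.\<close>

lemma vol0_E:
  assumes "\<And>i. i < 7 \<Longrightarrow> g i < 7"
  shows "vol0 (\<lambda>i. E (g i)) =
    - (\<Sum>\<sigma> | \<sigma> permutes {..<7}. if \<forall>i<7. g i = \<sigma> i then of_int (sign \<sigma>) else 0)"
  unfolding vol0_def
proof (intro arg_cong[where f = uminus] sum.cong refl)
  fix \<sigma> :: "nat \<Rightarrow> nat" assume "\<sigma> \<in> {\<sigma>. \<sigma> permutes {..<7}}"
  then have \<sigma>: "\<sigma> i < 7" if "i < 7" for i
    using that permutes_in_image[of \<sigma> "{..<7}" i] by auto
  have "E (g i) $ of_nat (Suc (\<sigma> i)) = (if g i = \<sigma> i then 1 else 0)" if "i < 7" for i
    using of_nat_Suc_inj_7[OF assms[OF that] \<sigma>[OF that]] by (simp add: axis_def eq_commute)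
  then have "(\<Prod>i<7. E (g i) $ of_nat (Suc (\<sigma> i))) = (\<Prod>i<7::nat. if g i = \<sigma> i then 1 else 0)"
    by (intro prod.cong) auto
  also have "\<dots> = (if \<forall>i<7. g i = \<sigma> i then 1 else 0)"
    by (auto intro!: prod.neutral)
  finally show "of_int (sign \<sigma>) * (\<Prod>i<7. E (g i) $ of_nat (Suc (\<sigma> i))) =
      (if \<forall>i<7. g i = \<sigma> i then of_int (sign \<sigma>) else 0)"
    by simp
qed

lemma vol0_E_permutes:
  assumes "\<tau> permutes {..<7}" "\<And>i. i < 7 \<Longrightarrow> v i = E (\<tau> i)"
  shows "vol0 v = - of_int (sign \<tau>)"
proof -
  have "vol0 v = vol0 (\<lambda>i. E (\<tau> i))"
    unfolding vol0_def using assms(2) by (intro arg_cong[where f = uminus] sum.cong arg_cong2[where f = "(*)"] prod.cong) auto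
  also have "\<dots> = - (\<Sum>\<sigma> | \<sigma> permutes {..<7}. if \<forall>i<7. \<tau> i = \<sigma> i then of_int (sign \<sigma>) else 0)"
    using permutes_in_image[OF assms(1)] by (intro vol0_E) auto
  also have "(\<Sum>\<sigma> | \<sigma> permutes {..<7}. if \<forall>i<7. \<tau> i = \<sigma> i then of_int (sign \<sigma>) else 0) =
     (\<Sum>\<sigma> | \<sigma> permutes {..<7}. if \<sigma> = \<tau> then of_int (sign \<sigma>) else (0::real))"
  proof (intro sum.cong if_cong refl)
    fix \<sigma> :: "nat \<Rightarrow> nat" assume "\<sigma> \<in> {\<sigma>. \<sigma> permutes {..<7}}"
    then show "(\<forall>i<7. \<tau> i = \<sigma> i) = (\<sigma> = \<tau>)"
      using assms(1) by (auto simp: permutes_def fun_eq_iff) (metis lessThan_iff)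
  qed
  also have "\<dots> = of_int (sign \<tau>)"
    using assms(1) by (simp add: sum.delta finite_permutations)
  finally show ?thesis .
qed

lemma vol0_E_not_inj:
  assumes "\<And>i. i < 7 \<Longrightarrow> v i = E (g i)" "\<And>i. i < 7 \<Longrightarrow> g i < 7" "\<not> inj_on g {..<7}"
  shows "vol0 v = 0"
proof -
  have "vol0 v = vol0 (\<lambda>i. E (g i))"
    unfolding vol0_def using assms(1) by (intro arg_cong[where f = uminus] sum.cong arg_cong2[where f = "(*)"] prod.cong) auto
  also have "\<dots> = - (\<Sum>\<sigma> | \<sigma> permutes {..<7}. if \<forall>i<7. g i = \<sigma> i then of_int (sign \<sigma>) else 0)"
    using assms(2) by (intro vol0_E) auto
  also have "\<dots> = 0"
  proof -
    have "\<not> (\<forall>i<7. g i = \<sigma> i)" if "\<sigma> permutes {..<7}" for \<sigma>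
      using assms(3) permutes_inj_on[OF that] by (metis inj_on_cong lessThan_iff)
    then show ?thesis
      by (intro neg_equal_0_iff_equal[THEN iffD2] sum.neutral) auto
  qed
  finally show ?thesis .
qed

lemma e3form_eq: "e3form i j k v =
     v 0 $ i * (v 1 $ j * v 2 $ k - v 2 $ j * v 1 $ k)
   - v 1 $ i * (v 0 $ j * v 2 $ k - v 2 $ j * v 0 $ k)
   + v 2 $ i * (v 0 $ j * v 1 $ k - v 1 $ j * v 0 $ k)"
  unfolding e3form_def e1form_def[abs_def]
  using wedge3_1forms[of "\<lambda>x. x $ i" "\<lambda>x. x $ j" "\<lambda>x. x $ k"] by simp

lemma phi0_permute:
  assumes "\<rho> permutes {..<3}"
  shows "phi0 (\<lambda>i. v (\<rho> i)) = of_int (sign \<rho>) * phi0 v"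
proof -
  \<comment> \<open>A single vanishing sum of absolute values packs the six identities together, so
    that \<open>sum_permutes_3\<close> can enumerate the permutations.\<close>
  have "(\<Sum>\<rho> | \<rho> permutes {..<3::nat}. \<bar>phi0 (\<lambda>i. v (\<rho> i)) - of_int (sign \<rho>) * phi0 v\<bar>) = 0"
    unfolding sum_permutes_3 phi0_def e3form_eq sign_perm_3
    by (simp add: sign_swap_id transpose_def) (simp add: algebra_simps)
  then show ?thesis using assms
    by (subst (asm) sum_nonneg_eq_0_iff) (auto simp: finite_permutations)
qed

text \<open>In the sum defining the star, \<open>vol0\<close> kills every \<open>f\<close> except
  the orderings of the three basis vectors complementary to the four arguments. Reordering them
  changes \<open>phi0\<close> and \<open>vol0\<close> by the same sign, so all 3! terms agree and
  cancel the factorial. The minus sign is that of \<open>vol0\<close>.\<close>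

lemma hodge0_phi0_E:
  assumes \<tau>: "\<tau> permutes {..<7}"
  shows "hodge0 3 phi0 (\<lambda>i. E (\<tau> (i + 3))) = - of_int (sign \<tau>) * phi0 (\<lambda>i. E (\<tau> i))"
proof -
  define ix :: "nat \<Rightarrow> 7" where "ix n = of_nat (Suc n)" for n
  define V where "V f = (\<lambda>i. if i < 3 then axis (f i) 1 else E (\<tau> (i - 3 + 3)))" for f :: "nat \<Rightarrow> 7"
  \<comment> \<open>The surviving index functions, parametrised by the orderings \<rho> of the first
    three positions.\<close>
  define F where "F \<rho> = restrict (\<lambda>i. ix (\<tau> (\<rho> i))) {..<3}" for \<rho> :: "nat \<Rightarrow> nat"
  let ?P = "{\<rho>. \<rho> permutes {..<3::nat}}"
  have ix_inj: "ix i = ix j \<longleftrightarrow> i = j" if "i < 7" "j < 7" for i j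
    using that of_nat_Suc_inj_7 by (simp add: ix_def)
  have ix_surj: "\<exists>i<7. k = ix i" for k
    using range_of_nat_Suc_7 unfolding ix_def image_image by (metis UNIV_I imageE lessThan_iff)
  have \<tau>7: "\<tau> i < 7 \<longleftrightarrow> i < 7" for i
    using permutes_in_image[OF \<tau>] by auto
  have \<tau>_inj: "\<tau> i = \<tau> j \<longleftrightarrow> i = j" for i j
    using permutes_inj[OF \<tau>] by (auto dest: injD)
  have \<rho>3: "\<rho> i < 3 \<longleftrightarrow> i < 3" if "\<rho> permutes {..<3}" for \<rho> i
    using permutes_in_image[OF that] by auto
  have "inj_on F ?P"
  proof (rule inj_onI)
    fix \<rho> \<rho>' assume \<rho>: "\<rho> \<in> ?P" "\<rho>' \<in> ?P" and eq: "F \<rho> = F \<rho>'"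
    have "\<rho> i = \<rho>' i" if i: "i < 3" for i
    proof -
      have "\<rho> i < 3" "\<rho>' i < 3"
        using \<rho>3 i \<rho> by auto
      then have "\<tau> (\<rho> i) < 7" "\<tau> (\<rho>' i) < 7"
        by (auto simp: \<tau>7)
      moreover have "ix (\<tau> (\<rho> i)) = ix (\<tau> (\<rho>' i))"
        using fun_cong[OF eq, of i] i by (simp add: F_def)
      ultimately show ?thesis
        by (simp add: ix_inj \<tau>_inj)
    qed
    then show "\<rho> = \<rho>'"
      using \<rho> by (auto simp: permutes_def fun_eq_iff) (metis lessThan_iff)
  qed
  have zero: "vol0 (V f) = 0" if f: "f \<in> {..<3} \<rightarrow>\<^sub>E UNIV" "f \<notin> F ` ?P" for f
  proof -
    have "\<exists>h. \<forall>i. h i < 7 \<and> f i = ix (\<tau> (h i))"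
    proof (rule choice, rule allI)
      fix i
      obtain j where "j < 7" "f i = ix j" using ix_surj by blast
      then show "\<exists>y<7. f i = ix (\<tau> y)"
        by (metis \<tau> \<tau>7 permutes_inverses(1))
    qed
    then obtain h where h: "\<And>i. h i < 7" "\<And>i. f i = ix (\<tau> (h i))"
      by metis
    define g where "g i = (if i < 3 then \<tau> (h i) else \<tau> i)" for i
    have "\<not> inj_on g {..<7}"
    proof
      assume inj: "inj_on g {..<7}"
      \<comment> \<open>On the seven indices \<open>g\<close> is \<tau> after this \<rho>. If
        \<open>g\<close> were injective there, \<rho> would be injective and fix everything from 3
        on, so it would permute the first three positions and \<open>f\<close> would be
        \<open>F \<rho>\<close>.\<close>
      define \<rho> where "\<rho> i = (if i < 3 then h i else i)" for i
      have \<rho>_inj: "inj \<rho>"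
      proof (rule injI)
        fix i j assume eq: "\<rho> i = \<rho> j"
        then have "i < 7 \<longleftrightarrow> j < 7"
          using h(1)[of i] h(1)[of j] by (auto simp: \<rho>_def split: if_splits)
        moreover have "g i = g j"
          using eq by (auto simp: g_def \<rho>_def split: if_splits)
        ultimately show "i = j"
          using inj eq by (auto simp: inj_on_def \<rho>_def split: if_splits)
      qed
      have "\<rho> i < 3" if "i < 3" for i
      proof (rule ccontr)
        assume "\<not> \<rho> i < 3"
        then have "\<rho> (\<rho> i) = \<rho> i"
          by (simp add: \<rho>_def)
        then show False
          using \<rho>_inj \<open>\<not> \<rho> i < 3\<close> that by (metis injD)
      qed
      then have "\<rho> ` {..<3} \<subseteq> {..<3}" by auto
      then have "bij_betw \<rho> {..<3} {..<3}"
        using endo_inj_surj[of "{..<3}" \<rho>] inj_on_subset[OF \<rho>_inj] by (simp add: bij_betw_def)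
      then have "\<rho> permutes {..<3}"
        by (rule bij_imp_permutes) (simp add: \<rho>_def)
      moreover have "f = F \<rho>"
        using f(1) h by (auto simp: F_def \<rho>_def fun_eq_iff PiE_def extensional_def)
      ultimately show False using f by blast
    qed
    moreover have "\<tau> (h i) < 7" for i
      using h(1) by (simp add: \<tau>7)
    ultimately show ?thesis
      by (intro vol0_E_not_inj[where g = g]) (auto simp: V_def g_def h ix_def \<tau>7)
  qed
  have val: "phi0 (\<lambda>i. axis (F \<rho> i) 1) * vol0 (V (F \<rho>)) = - of_int (sign \<tau>) * phi0 (\<lambda>i. E (\<tau> i))"
    if \<rho>: "\<rho> permutes {..<3}" for \<rho>
  proof -
    have "phi0 (\<lambda>i. axis (F \<rho> i) 1) = phi0 (\<lambda>i. E (\<tau> (\<rho> i)))"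
      unfolding phi0_def e3form_eq by (simp add: F_def ix_def)
    also have "\<dots> = of_int (sign \<rho>) * phi0 (\<lambda>i. E (\<tau> i))"
      using phi0_permute[OF \<rho>, of "\<lambda>i. E (\<tau> i)"] by simp
    finally have 1: "phi0 (\<lambda>i. axis (F \<rho> i) 1) = of_int (sign \<rho>) * phi0 (\<lambda>i. E (\<tau> i))" .
    have \<rho>7: "\<rho> permutes {..<7}"
      using \<rho> by (rule permutes_subset) auto
    have \<rho>id: "\<rho> i = i" if "\<not> i < 3" for i
      using \<rho> that by (auto simp: permutes_def)
    have "vol0 (V (F \<rho>)) = - of_int (sign (\<tau> \<circ> \<rho>))"
      by (rule vol0_E_permutes[OF permutes_compose[OF \<rho>7 \<tau>]]) (auto simp: V_def F_def ix_def \<rho>id)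
    also have "sign (\<tau> \<circ> \<rho>) = sign \<tau> * sign \<rho>"
      using \<tau> \<rho> by (intro sign_compose) (auto intro: permutes_imp_permutation[of "{..<_}"])
    finally show ?thesis
      unfolding 1 by (simp flip: of_int_mult)
  qed
  have "hodge0 3 phi0 (\<lambda>i. E (\<tau> (i + 3))) =
      (\<Sum>f \<in> {..<3} \<rightarrow>\<^sub>E UNIV. phi0 (\<lambda>i. axis (f i) 1) * vol0 (V f)) / fact 3"
    unfolding hodge0_def V_def by simp
  also have "(\<Sum>f \<in> {..<3} \<rightarrow>\<^sub>E UNIV. phi0 (\<lambda>i. axis (f i) 1) * vol0 (V f)) =
      (\<Sum>f \<in> F ` ?P. phi0 (\<lambda>i. axis (f i) 1) * vol0 (V f))"
  proof (intro sum.mono_neutral_right finite_PiE ballI)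
    show "F ` ?P \<subseteq> {..<3} \<rightarrow>\<^sub>E UNIV"
      unfolding F_def by (intro image_subsetI) simp
  qed (use zero in auto)
  also have "\<dots> = (\<Sum>\<rho> | \<rho> permutes {..<3::nat}. - of_int (sign \<tau>) * phi0 (\<lambda>i. E (\<tau> i)))"
    using \<open>inj_on F ?P\<close> val by (simp add: sum.reindex)
  also have "\<dots> = fact 3 * (- of_int (sign \<tau>) * phi0 (\<lambda>i. E (\<tau> i)))"
    by (simp add: card_permutations)
  finally show ?thesis by simp
qed

text \<open>The padding value 0 is tangent at every point and is preserved by linear maps. These
  sequences therefore meet conditions imposed on all entries and are mapped entrywise to sequences
  of the same kind.\<close>

definition tuple4 :: "'v \<Rightarrow> 'v \<Rightarrow> 'v \<Rightarrow> 'v \<Rightarrow> nat \<Rightarrow> 'v::zero" where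
  "tuple4 a b c d = (\<lambda>_. 0)(0 := a, 1 := b, 2 := c, 3 := d)"

lemma hodge0_cong:
  assumes "\<And>i. i < 7 - p \<Longrightarrow> v i = w i"
  shows "hodge0 p \<alpha> v = hodge0 p \<alpha> w"
proof -
  have "vol0 (\<lambda>i. if i < p then axis (f i) 1 else v (i - p)) =
        vol0 (\<lambda>i. if i < p then axis (f i) 1 else w (i - p))" for f
    unfolding vol0_def using assms
    by (intro arg_cong[where f = uminus] sum.cong arg_cong2[where f = "(*)"] prod.cong) auto
  then show ?thesis
    by (simp add: hodge0_def)
qed

lemma hodge0_phi0_tuple4:
  assumes "\<tau> permutes {..<7}"
    and "a = E (\<tau> 3)" "b = E (\<tau> 4)" "c = E (\<tau> 5)" "d = E (\<tau> 6)"
  shows "hodge0 3 phi0 (tuple4 a b c d) = - of_int (sign \<tau>) * phi0 (\<lambda>i. E (\<tau> i))"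
proof -
  have "hodge0 3 phi0 (tuple4 a b c d) = hodge0 3 phi0 (\<lambda>i. E (\<tau> (i + 3)))"
  proof (rule hodge0_cong)
    fix i :: nat assume "i < 7 - 3"
    then have "i = 0 \<or> i = 1 \<or> i = 2 \<or> i = 3"
      by arith
    then show "tuple4 a b c d i = E (\<tau> (i + 3))"
      using assms(2-) by (elim disjE) (simp_all add: tuple4_def)
  qed
  then show ?thesis
    using hodge0_phi0_E[OF assms(1)] by simp
qed

text \<open>For each value, \<tau> sends 3, ..., 6 to the four given vectors, counted from 0, and 0,
  1, 2 to the complementary ones, which form a triple of \<open>phi0\<close>. The first three values
  are those of \<open>\<omega>\<^sup>2 / 2\<close>, the other four those of
  \<open>- dt \<and> \<Omega>\<^sub>2\<close> with \<open>e\<^sup>4 = - dt\<close>.\<close>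

lemma hodge0_phi0_values:
  shows "hodge0 3 phi0 (tuple4 (axis 1 1) (axis 2 1) (axis 5 1) (axis 6 1)) = -1"
    and "hodge0 3 phi0 (tuple4 (axis 2 1) (axis 3 1) (axis 6 1) (axis 7 1)) = -1"
    and "hodge0 3 phi0 (tuple4 (axis 3 1) (axis 1 1) (axis 7 1) (axis 5 1)) = -1"
    and "hodge0 3 phi0 (tuple4 (axis 4 1) (axis 5 1) (axis 6 1) (axis 7 1)) = -1"
    and "hodge0 3 phi0 (tuple4 (axis 4 1) (axis 1 1) (axis 2 1) (axis 7 1)) = 1"
    and "hodge0 3 phi0 (tuple4 (axis 4 1) (axis 2 1) (axis 3 1) (axis 5 1)) = 1"
    and "hodge0 3 phi0 (tuple4 (axis 4 1) (axis 3 1) (axis 1 1) (axis 6 1)) = 1"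
proof -
  show "hodge0 3 phi0 (tuple4 (axis 1 1) (axis 2 1) (axis 5 1) (axis 6 1)) = -1"
    by (subst hodge0_phi0_tuple4[where \<tau> = "Transposition.transpose 0 (3::nat) \<circ> Transposition.transpose 1 (6::nat) \<circ> Transposition.transpose 4 (6::nat) \<circ> Transposition.transpose 5 (6::nat)"])
      (auto intro!: permutes_id permutes_compose permutes_swap_id simp: sign_compose permutation_compose permutation_swap_id
         sign_swap_id phi0_def e3form_eq axis_def transpose_def)
  show "hodge0 3 phi0 (tuple4 (axis 2 1) (axis 3 1) (axis 6 1) (axis 7 1)) = -1"
    by (subst hodge0_phi0_tuple4[where \<tau> = "Transposition.transpose 1 (3::nat) \<circ> Transposition.transpose 2 (4::nat)"])
      (auto intro!: permutes_id permutes_compose permutes_swap_id simp: sign_compose permutation_compose permutation_swap_id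
         sign_swap_id phi0_def e3form_eq axis_def transpose_def)
  show "hodge0 3 phi0 (tuple4 (axis 3 1) (axis 1 1) (axis 7 1) (axis 5 1)) = -1"
    by (subst hodge0_phi0_tuple4[where \<tau> = "Transposition.transpose 0 (5::nat) \<circ> Transposition.transpose 2 (3::nat) \<circ> Transposition.transpose 4 (5::nat) \<circ> Transposition.transpose 5 (6::nat)"])
      (auto intro!: permutes_id permutes_compose permutes_swap_id simp: sign_compose permutation_compose permutation_swap_id
         sign_swap_id phi0_def e3form_eq axis_def transpose_def)
  show "hodge0 3 phi0 (tuple4 (axis 4 1) (axis 5 1) (axis 6 1) (axis 7 1)) = -1"
    by (subst hodge0_phi0_tuple4[where \<tau> = id])
      (auto intro!: permutes_id permutes_compose permutes_swap_id simp: sign_compose permutation_compose permutation_swap_id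
         sign_swap_id phi0_def e3form_eq axis_def transpose_def)
  show "hodge0 3 phi0 (tuple4 (axis 4 1) (axis 1 1) (axis 2 1) (axis 7 1)) = 1"
    by (subst hodge0_phi0_tuple4[where \<tau> = "Transposition.transpose 0 (4::nat) \<circ> Transposition.transpose 1 (5::nat)"])
      (auto intro!: permutes_id permutes_compose permutes_swap_id simp: sign_compose permutation_compose permutation_swap_id
         sign_swap_id phi0_def e3form_eq axis_def transpose_def)
  show "hodge0 3 phi0 (tuple4 (axis 4 1) (axis 2 1) (axis 3 1) (axis 5 1)) = 1"
    by (subst hodge0_phi0_tuple4[where \<tau> = "Transposition.transpose 1 (6::nat) \<circ> Transposition.transpose 2 (5::nat) \<circ> Transposition.transpose 4 (6::nat)"])
      (auto intro!: permutes_id permutes_compose permutes_swap_id simp: sign_compose permutation_compose permutation_swap_id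
         sign_swap_id phi0_def e3form_eq axis_def transpose_def)
  show "hodge0 3 phi0 (tuple4 (axis 4 1) (axis 3 1) (axis 1 1) (axis 6 1)) = 1"
    by (subst hodge0_phi0_tuple4[where \<tau> = "Transposition.transpose 0 (6::nat) \<circ> Transposition.transpose 2 (4::nat) \<circ> Transposition.transpose 5 (6::nat)"])
      (auto intro!: permutes_id permutes_compose permutes_swap_id simp: sign_compose permutation_compose permutation_swap_id
         sign_swap_id phi0_def e3form_eq axis_def transpose_def)
qed

section \<open>Invariant closed forms along a curve\<close>

lemma smooth_on_differentiable:
  assumes "smooth_on U f" "x \<in> U"
  shows "f differentiable (at x)"
proof -
  have "k_times_differentiable_on (Suc 0) U f"
    using assms(1) unfolding smooth_on_def by blast
  then show ?thesis
    using assms(2) by (auto simp: differentiable_def)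
qed

lemma alt_form_cong: "alt_form k \<alpha> \<Longrightarrow> (\<And>i. i < k \<Longrightarrow> v i = w i) \<Longrightarrow> \<alpha> v = \<alpha> w"
  by (simp add: alt_form_def)

lemma alt_form_linear: "alt_form k \<alpha> \<Longrightarrow> i < k \<Longrightarrow> linear (\<lambda>u. \<alpha> (v(i := u)))"
  by (simp add: alt_form_def)

lemma alt_form_expand:
  fixes \<alpha> :: "'v::euclidean_space form"
  assumes "alt_form k \<alpha>" "i < k"
  shows "\<alpha> (v(i := u)) = (\<Sum>b\<in>Basis. (u \<bullet> b) * \<alpha> (v(i := b)))"
proof -
  interpret linear "\<lambda>u. \<alpha> (v(i := u))"
    using assms by (rule alt_form_linear)
  have "\<alpha> (v(i := u)) = \<alpha> (v(i := (\<Sum>b\<in>Basis. (u \<bullet> b) *\<^sub>R b)))"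
    by (simp add: euclidean_representation)
  then show ?thesis
    by (simp add: sum scale)
qed

text \<open>Differentiation in the base point respects linearity in a frozen slot. The expansion is
  known on \<open>U\<close> only, so openness of \<open>U\<close> is what makes it differentiable at
  \<open>x\<close>.\<close>

lemma frechet_derivative_form_expand:
  fixes \<Psi> :: "'v::euclidean_space \<Rightarrow> 'v form"
  assumes "open U" "x \<in> U" "\<And>y. y \<in> U \<Longrightarrow> alt_form k (\<Psi> y)" "i < k"
    and diff: "\<And>v. (\<lambda>y. \<Psi> y v) differentiable (at x)"
  shows "frechet_derivative (\<lambda>y. \<Psi> y (v(i := u))) (at x) z =
    (\<Sum>b\<in>Basis. (u \<bullet> b) * frechet_derivative (\<lambda>y. \<Psi> y (v(i := b))) (at x) z)"
proof -
  have "((\<lambda>y. \<Sum>b\<in>Basis. (u \<bullet> b) * \<Psi> y (v(i := b))) has_derivative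
     (\<lambda>z. \<Sum>b\<in>Basis. (u \<bullet> b) * frechet_derivative (\<lambda>y. \<Psi> y (v(i := b))) (at x) z)) (at x)"
    by (intro has_derivative_sum has_derivative_mult_right iffD1[OF frechet_derivative_works] diff)
  then have "((\<lambda>y. \<Psi> y (v(i := u))) has_derivative
     (\<lambda>z. \<Sum>b\<in>Basis. (u \<bullet> b) * frechet_derivative (\<lambda>y. \<Psi> y (v(i := b))) (at x) z)) (at x)"
    by (rule has_derivative_transform_within_open[OF _ assms(1,2)])
      (simp add: alt_form_expand[OF assms(3,4), symmetric])
  from frechet_derivative_at[OF this] show ?thesis
    by (metis (lifting))
qed

text \<open>The Leibniz rule, by induction on the number \<open>n\<close> of moving slots; the slots
  from \<open>n\<close> on hold the constant vectors \<open>v\<close>. To release one more slot, its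
  vector is expanded in the standard basis, which leaves products of scalar coordinates with forms
  covered by the induction hypothesis.\<close>

lemma form_along_curve_derivative:
  fixes \<Psi> :: "'v::euclidean_space \<Rightarrow> 'v form"
  assumes U: "open U" "x t \<in> U" and alt: "\<And>y. y \<in> U \<Longrightarrow> alt_form k (\<Psi> y)"
    and diff: "\<And>v. (\<lambda>y. \<Psi> y v) differentiable (at (x t))"
    and x: "(x has_vector_derivative x') (at t)"
    and w: "\<And>i. i < k \<Longrightarrow> ((\<lambda>s. w s i) has_vector_derivative w' i) (at t)"
    and "n \<le> k"
  shows "((\<lambda>s. \<Psi> (x s) (\<lambda>i. if i < n then w s i else v i)) has_real_derivative
           frechet_derivative (\<lambda>y. \<Psi> y (\<lambda>i. if i < n then w t i else v i)) (at (x t)) x' +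
           (\<Sum>i<n. \<Psi> (x t) ((\<lambda>j. if j < n then w t j else v j)(i := w' i)))) (at t)"
  using \<open>n \<le> k\<close>
proof (induction n arbitrary: v)
  case 0
  have "((\<lambda>y. \<Psi> y v) has_derivative frechet_derivative (\<lambda>y. \<Psi> y v) (at (x t))) (at (x t) within range x)"
    using iffD1[OF frechet_derivative_works diff] by (rule has_derivative_at_withinI)
  from vector_derivative_diff_chain_within[OF x this]
  show ?case
    by (simp add: has_real_derivative_iff_has_vector_derivative o_def)
next
  case (Suc n)
  define W where "W s = (\<lambda>i. if i < n then w s i else v i)" for s
  have W1: "(\<lambda>i. if i < Suc n then w s i else v i) = (W s)(n := w s n)" for s
    by (auto simp: W_def)
  \<comment> \<open>The induction hypothesis is used with a basis vector \<open>b\<close> frozen in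
    slot \<open>n\<close>, which is why it is stated for arbitrary \<open>v\<close>.\<close>
  have W2: "(\<lambda>i. if i < n then w s i else (v(n := b)) i) = (W s)(n := b)" for s b
    by (auto simp: W_def)
  have nk: "n < k"
    using Suc.prems by simp
  let ?D = "\<lambda>v. frechet_derivative (\<lambda>y. \<Psi> y v) (at (x t)) x'"
  have IH: "((\<lambda>s. \<Psi> (x s) ((W s)(n := b))) has_real_derivative
     ?D ((W t)(n := b)) + (\<Sum>i<n. \<Psi> (x t) ((W t)(i := w' i, n := b)))) (at t)" for b
  proof -
    have "((W t)(n := b))(i := w' i) = (W t)(i := w' i, n := b)" if "i < n" for i
      using that by (auto simp: fun_upd_twist)
    then have *: "(\<Sum>i<n. \<Psi> (x t) (((W t)(n := b))(i := w' i))) = (\<Sum>i<n. \<Psi> (x t) ((W t)(i := w' i, n := b)))"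
      by (intro sum.cong refl) (simp only: lessThan_iff)
    show ?thesis
      using Suc.IH[of "v(n := b)"] Suc.prems unfolding W2 * by (simp only: Suc_leD simp_thms)
  qed
  have wn: "((\<lambda>s. w s n \<bullet> b) has_real_derivative w' n \<bullet> b) (at t)" for b
    using bounded_linear.has_vector_derivative[OF bounded_linear_inner_left w[OF nk]]
    by (simp add: has_real_derivative_iff_has_vector_derivative)
  have "((\<lambda>s. \<Sum>b\<in>Basis. (w s n \<bullet> b) * \<Psi> (x s) ((W s)(n := b))) has_real_derivative
     (\<Sum>b\<in>Basis. (w' n \<bullet> b) * \<Psi> (x t) ((W t)(n := b)) +
        (?D ((W t)(n := b)) + (\<Sum>i<n. \<Psi> (x t) ((W t)(i := w' i, n := b)))) * (w t n \<bullet> b))) (at t)"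
    by (intro DERIV_sum DERIV_mult IH wn)
  moreover have "(\<Sum>b\<in>Basis. (w' n \<bullet> b) * \<Psi> (x t) ((W t)(n := b)) +
        (?D ((W t)(n := b)) + (\<Sum>i<n. \<Psi> (x t) ((W t)(i := w' i, n := b)))) * (w t n \<bullet> b))
      = ?D ((W t)(n := w t n)) + (\<Sum>i<Suc n. \<Psi> (x t) ((W t)(n := w t n, i := w' i)))"
  proof -
    have 1: "(W t)(n := w t n, i := w' i) = (W t)(i := w' i, n := w t n)" if "i < n" for i
      using that by (auto simp: fun_upd_twist)
    have "(\<Sum>i<n. \<Psi> (x t) ((W t)(n := w t n, i := w' i))) =
       (\<Sum>i<n. \<Sum>b\<in>Basis. (w t n \<bullet> b) * \<Psi> (x t) ((W t)(i := w' i, n := b)))"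
      by (intro sum.cong refl) (simp add: 1 alt_form_expand[OF alt[OF U(2)] nk, symmetric])
    also have "\<dots> = (\<Sum>b\<in>Basis. (w t n \<bullet> b) * (\<Sum>i<n. \<Psi> (x t) ((W t)(i := w' i, n := b))))"
      unfolding sum_distrib_left by (rule sum.swap)
    finally have 2: "(\<Sum>i<n. \<Psi> (x t) ((W t)(n := w t n, i := w' i))) = \<dots>" .
    have 3: "\<Psi> (x t) ((W t)(n := w' n)) = (\<Sum>b\<in>Basis. (w' n \<bullet> b) * \<Psi> (x t) ((W t)(n := b)))"
      by (rule alt_form_expand[OF alt[OF U(2)] nk])
    have 4: "?D ((W t)(n := w t n)) = (\<Sum>b\<in>Basis. (w t n \<bullet> b) * ?D ((W t)(n := b)))"
      by (rule frechet_derivative_form_expand[OF U alt nk diff])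
    show ?thesis
      unfolding sum.lessThan_Suc 2 4
      by (simp add: 3 sum.distrib algebra_simps)
  qed
  \<comment> \<open>Away from \<open>t\<close> the curve may leave \<open>U\<close>, where the form
    need not be multilinear; agreement near \<open>t\<close> is enough for the derivative.\<close>
  moreover have "\<forall>\<^sub>F s in nhds t. (\<Sum>b\<in>Basis. (w s n \<bullet> b) * \<Psi> (x s) ((W s)(n := b))) =
     \<Psi> (x s) ((W s)(n := w s n))"
  proof -
    have "isCont x t"
      using x by (rule has_vector_derivative_continuous)
    then have "\<forall>\<^sub>F s in nhds t. x s \<in> U"
      using U by (auto simp: isCont_def tendsto_at_iff_tendsto_nhds intro: topological_tendstoD)
    then show ?thesis
      by eventually_elim (rule alt_form_expand[OF alt nk, symmetric])
  qed
  ultimately have "((\<lambda>s. \<Psi> (x s) ((W s)(n := w s n))) has_real_derivative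
      ?D ((W t)(n := w t n)) + (\<Sum>i<Suc n. \<Psi> (x t) ((W t)(n := w t n, i := w' i)))) (at t)"
    by (subst (asm) DERIV_cong_ev[OF refl _ refl]) auto
  then show ?case
    unfolding W1 .
qed

section \<open>Multilinearity and alternation on tuples\<close>

lemma tuple4_upd [simp]:
  "(tuple4 a b c d)(0 := x) = tuple4 x b c d" "(tuple4 a b c d)(1 := x) = tuple4 a x c d"
  "(tuple4 a b c d)(Suc 0 := x) = tuple4 a x c d"
  "(tuple4 a b c d)(2 := x) = tuple4 a b x d" "(tuple4 a b c d)(3 := x) = tuple4 a b c x"
  by (auto simp: tuple4_def)

lemma tuple4_nth [simp]:
  "tuple4 a b c d 0 = a" "tuple4 a b c d 1 = b" "tuple4 a b c d (Suc 0) = b" "tuple4 a b c d 2 = c" "tuple4 a b c d 3 = d"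
  by (auto simp: tuple4_def)

lemma less_4_cases: "(\<forall>i<4. P i) \<longleftrightarrow> P 0 \<and> P 1 \<and> P 2 \<and> P (3::nat)"
  by (auto simp: eval_nat_numeral less_Suc_eq)

lemma alt_form_tuple4:
  assumes "alt_form 4 \<alpha>"
  shows "linear (\<lambda>x. \<alpha> (tuple4 x b c d))" "linear (\<lambda>x. \<alpha> (tuple4 a x c d))"
    "linear (\<lambda>x. \<alpha> (tuple4 a b x d))" "linear (\<lambda>x. \<alpha> (tuple4 a b c x))"
  using alt_form_linear[OF assms, of 0 "tuple4 0 b c d"] alt_form_linear[OF assms, of 1 "tuple4 a 0 c d"]
    alt_form_linear[OF assms, of 2 "tuple4 a b 0 d"] alt_form_linear[OF assms, of 3 "tuple4 a b c 0"]
  by simp_all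

text \<open>Polarisation: a form vanishing on repeated arguments is expanded on a repeated
  sum.\<close>

lemma alt_form_tuple4_swap:
  assumes "alt_form 4 \<alpha>"
  shows "\<alpha> (tuple4 b a c d) = - \<alpha> (tuple4 a b c d)" "\<alpha> (tuple4 a c b d) = - \<alpha> (tuple4 a b c d)"
    "\<alpha> (tuple4 a b d c) = - \<alpha> (tuple4 a b c d)"
proof -
  have z: "\<alpha> v = 0" if "i < 4" "j < 4" "i \<noteq> j" "v i = v j" for v i j
    using assms that unfolding alt_form_def by blast
  note l = alt_form_tuple4[OF assms, THEN linear_add]
  have "\<alpha> (tuple4 (a + b) (a + b) c d) = 0" "\<alpha> (tuple4 a a c d) = 0" "\<alpha> (tuple4 b b c d) = 0"
    by (rule z[of 0 1], simp_all)+
  then show "\<alpha> (tuple4 b a c d) = - \<alpha> (tuple4 a b c d)"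
    by (simp add: l)
  have "\<alpha> (tuple4 a (b + c) (b + c) d) = 0" "\<alpha> (tuple4 a b b d) = 0" "\<alpha> (tuple4 a c c d) = 0"
    by (rule z[of 1 2], simp_all)+
  then show "\<alpha> (tuple4 a c b d) = - \<alpha> (tuple4 a b c d)"
    by (simp add: l)
  have "\<alpha> (tuple4 a b (c + d) (c + d)) = 0" "\<alpha> (tuple4 a b c c) = 0" "\<alpha> (tuple4 a b d d) = 0"
    by (rule z[of 2 3], simp_all)+
  then show "\<alpha> (tuple4 a b d c) = - \<alpha> (tuple4 a b c d)"
    by (simp add: l)
qed

section \<open>Consequences of invariance and closedness\<close>

lemma zero_tan [simp]: "0 \<in> tan_S3xS4 x"
  by (simp add: tan_S3xS4_def)

lemma tuple4_tan: "{a, b, c, d} \<subseteq> tan_S3xS4 x \<Longrightarrow> tuple4 a b c d i \<in> tan_S3xS4 x"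
  by (simp add: tuple4_def)

text \<open>A unit imaginary quaternion squares to -1, so this curve is its exponential.\<close>

lemma one_parameter_subgroup:
  assumes "e \<in> su2" "norm e = 1"
  shows "cos s *\<^sub>R qone + sin s *\<^sub>R e \<in> SU2"
    and "((\<lambda>s. cos s *\<^sub>R qone + sin s *\<^sub>R e) has_vector_derivative e) (at 0)"
proof -
  have "qone \<bullet> e = 0" "qone \<bullet> qone = 1" "e \<bullet> e = 1"
    using assms by (simp_all add: su2_def inner_prod_def qone_def norm_eq_1)
  then show "cos s *\<^sub>R qone + sin s *\<^sub>R e \<in> SU2"
    by (simp add: SU2_iff inner_add_left inner_add_right inner_commute[of e qone] flip: power2_eq_square)
  show "((\<lambda>s. cos s *\<^sub>R qone + sin s *\<^sub>R e) has_vector_derivative e) (at 0)"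
    by (auto intro!: derivative_eq_intros)
qed

text \<open>The vanishing of the Lie derivative along \<open>fund_field u\<close>, obtained by
  differentiating the invariance along a one-parameter curve in \<open>G\<close>. The unit norms are
  those required for the trigonometric form of that curve.\<close>

lemma invariant_form_infinitesimal:
  assumes ext: "extends_form 4 \<psi> U \<Psi>"
    and inv: "\<forall>a\<in>G. \<forall>x\<in>S3xS4. \<forall>v. (\<forall>i. v i \<in> tan_S3xS4 x) \<longrightarrow>
          \<psi> (act a x) (\<lambda>i. act a (v i)) = \<psi> x v"
    and x: "x \<in> S3xS4" and v: "\<And>i. v i \<in> tan_S3xS4 x"
    and u: "fst u \<in> su2" "snd u \<in> su2" "norm (fst u) = 1" "norm (snd u) = 1"
  shows "frechet_derivative (\<lambda>y. \<Psi> y v) (at x) (fund_field u x) +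
    (\<Sum>i<4. \<Psi> x (v(i := fund_field u (v i)))) = 0"
proof -
  have U: "open U" "S3xS4 \<subseteq> U" and alt: "\<And>y. y \<in> U \<Longrightarrow> alt_form 4 (\<Psi> y)"
    and sm: "\<And>v. smooth_on U (\<lambda>x. \<Psi> x v)"
    and eq: "\<And>x v. x \<in> S3xS4 \<Longrightarrow> (\<And>i. i < 4 \<Longrightarrow> v i \<in> tan_S3xS4 x) \<Longrightarrow> \<psi> x v = \<Psi> x v"
    using ext by (auto simp: extends_form_def)
  define c where "c s = (cos s *\<^sub>R qone + sin s *\<^sub>R fst u, cos s *\<^sub>R qone + sin s *\<^sub>R snd u)" for s
  have cG: "c s \<in> G" for s
    using one_parameter_subgroup(1) u by (simp add: c_def G_def)
  have c0: "c 0 = (qone, qone)"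
    by (simp add: c_def)
  have "(c has_vector_derivative (fst u, snd u)) (at 0)"
    unfolding c_def by (intro has_vector_derivative_Pair one_parameter_subgroup u)
  then have c': "(c has_derivative (\<lambda>h. h *\<^sub>R u)) (at 0)"
    by (simp add: has_vector_derivative_def)
  have act': "((\<lambda>s. act (c s) y) has_vector_derivative fund_field u y) (at 0)" for y
  proof -
    have "((\<lambda>s. act (c s) y) has_derivative (\<lambda>h. 0 + fund_field (h *\<^sub>R u) y)) (at 0)"
      by (intro act_has_derivative c' c0) (rule has_derivative_const)
    then show ?thesis
      by (simp add: has_vector_derivative_def linear_scale[OF fund_field_linear_left])
  qed
  have act0: "act (c 0) y = y" for y
    by (simp add: c0 act_def)
  have "((\<lambda>s. \<Psi> (act (c s) x) (\<lambda>i. if i < 4 then act (c s) (v i) else v i)) has_real_derivative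
       frechet_derivative (\<lambda>y. \<Psi> y (\<lambda>i. if i < 4 then act (c 0) (v i) else v i)) (at (act (c 0) x)) (fund_field u x) +
       (\<Sum>i<4. \<Psi> (act (c 0) x) ((\<lambda>j. if j < 4 then act (c 0) (v j) else v j)(i := fund_field u (v i))))) (at 0)"
    using U x by (intro form_along_curve_derivative[where U = U and k = 4] alt act' smooth_on_differentiable[OF sm])
      (auto simp: act0)
  \<comment> \<open>Only \<psi> is invariant, not its extension \<Psi>. The moved point stays on the
    manifold and the moved vectors stay tangent, where the two forms agree.\<close>
  moreover have "\<Psi> (act (c s) x) (\<lambda>i. if i < 4 then act (c s) (v i) else v i) = \<Psi> x v" for s
  proof -
    have S: "act (c s) x \<in> S3xS4"
      by (rule act_S3xS4[OF cG x])
    have "\<Psi> (act (c s) x) (\<lambda>i. if i < 4 then act (c s) (v i) else v i) =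
          \<Psi> (act (c s) x) (\<lambda>i. act (c s) (v i))"
      using S U by (intro alt_form_cong[OF alt]) auto
    also have "\<dots> = \<psi> (act (c s) x) (\<lambda>i. act (c s) (v i))"
      using v act_tan[OF cG] by (intro eq[OF S, symmetric]) auto
    also have "\<dots> = \<psi> x v"
      using inv cG x v by blast
    also have "\<dots> = \<Psi> x v"
      using x v by (rule eq)
    finally show ?thesis .
  qed
  ultimately have "((\<lambda>s::real. \<Psi> x v) has_real_derivative
       frechet_derivative (\<lambda>y. \<Psi> y v) (at x) (fund_field u x) +
       (\<Sum>i<4. \<Psi> x (v(i := fund_field u (v i))))) (at 0)"
    by (simp add: act0 cong: if_cong)
  from DERIV_unique[OF this DERIV_const] show ?thesis .
qed

text \<open>Each \<open>fund_field (u i)\<close> is linear, so along the curve its derivative is the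
  same field applied to \<gamma>'. Tangency of \<gamma>' is not involved, so the formula is also
  available at the two ends of the geodesic.\<close>

lemma fund_field_form_curve_derivative:
  fixes u :: "nat \<Rightarrow> quat \<times> quat"
  assumes ext: "extends_form 4 \<psi> U \<Psi>"
    and \<gamma>: "(\<gamma> has_vector_derivative \<gamma>') (at t)" "\<gamma> t \<in> S3xS4"
  defines "m \<equiv> \<lambda>i. fund_field (u i) (\<gamma> t)" and "Q \<equiv> \<lambda>a b c d. \<Psi> (\<gamma> t) (tuple4 a b c d)"
  shows "((\<lambda>s. \<Psi> (\<gamma> s) (tuple4 (fund_field (u 0) (\<gamma> s)) (fund_field (u 1) (\<gamma> s)) (fund_field (u 2) (\<gamma> s)) (fund_field (u 3) (\<gamma> s))))
    has_real_derivative frechet_derivative (\<lambda>y. \<Psi> y (tuple4 (m 0) (m 1) (m 2) (m 3))) (at (\<gamma> t)) \<gamma>'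
      + (Q (fund_field (u 0) \<gamma>') (m 1) (m 2) (m 3)
      + Q (m 0) (fund_field (u 1) \<gamma>') (m 2) (m 3) + Q (m 0) (m 1) (fund_field (u 2) \<gamma>') (m 3)
      + Q (m 0) (m 1) (m 2) (fund_field (u 3) \<gamma>'))) (at t)"
proof -
  have U: "open U" "\<gamma> t \<in> U" and alt: "\<And>y. y \<in> U \<Longrightarrow> alt_form 4 (\<Psi> y)"
    and sm: "\<And>v. smooth_on U (\<lambda>x. \<Psi> x v)"
    using ext \<gamma> by (auto simp: extends_form_def)
  have w: "((\<lambda>s. tuple4 (fund_field (u 0) (\<gamma> s)) (fund_field (u 1) (\<gamma> s)) (fund_field (u 2) (\<gamma> s)) (fund_field (u 3) (\<gamma> s)) i)
    has_vector_derivative tuple4 (fund_field (u 0) \<gamma>') (fund_field (u 1) \<gamma>') (fund_field (u 2) \<gamma>') (fund_field (u 3) \<gamma>') i) (at t)"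
    if "i < 4" for i :: nat
  proof -
    have "((\<lambda>s. fund_field e (\<gamma> s)) has_vector_derivative fund_field e \<gamma>') (at t)" for e
      using bounded_linear.has_vector_derivative[OF linear_conv_bounded_linear[THEN iffD1, OF fund_field_linear] \<gamma>(1)] .
    then have "\<forall>i<4. ((\<lambda>s. tuple4 (fund_field (u 0) (\<gamma> s)) (fund_field (u 1) (\<gamma> s)) (fund_field (u 2) (\<gamma> s)) (fund_field (u 3) (\<gamma> s)) i)
        has_vector_derivative tuple4 (fund_field (u 0) \<gamma>') (fund_field (u 1) \<gamma>') (fund_field (u 2) \<gamma>') (fund_field (u 3) \<gamma>') i) (at t)"
      unfolding less_4_cases by simp
    with that show ?thesis by blast
  qed
  have tuple4_if: "(\<lambda>i. if i < 4 then tuple4 a b c d i else 0) = tuple4 a b c d" for a b c d :: pt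
    by (auto simp: tuple4_def)
  have sum4: "(\<Sum>i<4. g i) = g 0 + g 1 + g 2 + g (3::nat)" for g :: "nat \<Rightarrow> real"
    by (simp add: eval_nat_numeral)
  show ?thesis
    using form_along_curve_derivative[where n = 4 and v = "\<lambda>_. 0"
       and w = "\<lambda>s. tuple4 (fund_field (u 0) (\<gamma> s)) (fund_field (u 1) (\<gamma> s)) (fund_field (u 2) (\<gamma> s)) (fund_field (u 3) (\<gamma> s))"
       and w' = "tuple4 (fund_field (u 0) \<gamma>') (fund_field (u 1) \<gamma>') (fund_field (u 2) \<gamma>') (fund_field (u 3) \<gamma>')", OF U alt smooth_on_differentiable[OF sm U(2)] \<gamma>(1) w order_refl]
    unfolding tuple4_if by (simp add: sum4 m_def Q_def)
qed

text \<open>Closedness trades the derivative along \<gamma>' for derivatives along the fundamental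
  fields, and infinitesimal invariance trades those for algebraic terms. The terms with a field
  applied to \<gamma>' cancel; the rest pair up into commutators.\<close>

lemma closed_form_fund_field_derivative:
  fixes u :: "nat \<Rightarrow> quat \<times> quat"
  assumes ext: "extends_form 4 \<psi> U \<Psi>"
    and closed: "\<forall>x\<in>S3xS4. \<forall>v. (\<forall>i\<le>4. v i \<in> tan_S3xS4 x) \<longrightarrow> ext_deriv 4 \<Psi> x v = 0"
    and inv: "\<forall>a\<in>G. \<forall>x\<in>S3xS4. \<forall>v. (\<forall>i. v i \<in> tan_S3xS4 x) \<longrightarrow>
          \<psi> (act a x) (\<lambda>i. act a (v i)) = \<psi> x v"
    and \<gamma>: "(\<gamma> has_vector_derivative \<gamma>') (at t)" "\<gamma> t \<in> S3xS4" "\<gamma>' \<in> tan_S3xS4 (\<gamma> t)"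
    and u: "\<forall>i<4. fst (u i) \<in> su2 \<and> snd (u i) \<in> su2 \<and> norm (fst (u i)) = 1 \<and> norm (snd (u i)) = 1"
  defines "m \<equiv> \<lambda>i. fund_field (u i) (\<gamma> t)"
    and "c \<equiv> \<lambda>i j. fund_field (u i) (fund_field (u j) (\<gamma> t)) - fund_field (u j) (fund_field (u i) (\<gamma> t))"
    and "Q \<equiv> \<lambda>a b c d. \<Psi> (\<gamma> t) (tuple4 a b c d)"
  shows "((\<lambda>s. \<Psi> (\<gamma> s) (tuple4 (fund_field (u 0) (\<gamma> s)) (fund_field (u 1) (\<gamma> s)) (fund_field (u 2) (\<gamma> s)) (fund_field (u 3) (\<gamma> s))))
    has_real_derivative
     - Q \<gamma>' (c 0 1) (m 2) (m 3) - Q \<gamma>' (m 1) (c 0 2) (m 3) - Q \<gamma>' (m 1) (m 2) (c 0 3)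
     + Q \<gamma>' (m 0) (c 1 2) (m 3) + Q \<gamma>' (m 0) (m 2) (c 1 3) - Q \<gamma>' (m 0) (m 1) (c 2 3)) (at t)"
proof -
  have U: "open U" "\<gamma> t \<in> U" and alt: "\<And>y. y \<in> U \<Longrightarrow> alt_form 4 (\<Psi> y)"
    and sm: "\<And>v. smooth_on U (\<lambda>x. \<Psi> x v)"
    using ext \<gamma> by (auto simp: extends_form_def)
  define D where "D v z = frechet_derivative (\<lambda>y. \<Psi> y v) (at (\<gamma> t)) z" for v z
  have m_tan: "m i \<in> tan_S3xS4 (\<gamma> t)" if "i < 4" for i
    unfolding m_def using u that by (intro fund_field_tan) auto
  have sum4: "(\<Sum>i<4. g i) = g 0 + g 1 + g 2 + g (3::nat)" for g :: "nat \<Rightarrow> real"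
    by (simp add: eval_nat_numeral)
  have der: "((\<lambda>s. \<Psi> (\<gamma> s) (tuple4 (fund_field (u 0) (\<gamma> s)) (fund_field (u 1) (\<gamma> s)) (fund_field (u 2) (\<gamma> s)) (fund_field (u 3) (\<gamma> s))))
    has_real_derivative D (tuple4 (m 0) (m 1) (m 2) (m 3)) \<gamma>' + (Q (fund_field (u 0) \<gamma>') (m 1) (m 2) (m 3)
      + Q (m 0) (fund_field (u 1) \<gamma>') (m 2) (m 3) + Q (m 0) (m 1) (fund_field (u 2) \<gamma>') (m 3)
      + Q (m 0) (m 1) (m 2) (fund_field (u 3) \<gamma>'))) (at t)"
    using fund_field_form_curve_derivative[OF ext \<gamma>(1,2), of u] by (simp add: D_def m_def Q_def)
  \<comment> \<open>The exterior derivative on \<gamma>' and the four fields, whose vectors are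
    frozen at \<gamma> t; hence no bracket terms at this stage.\<close>
  have ext0: "D (tuple4 (m 0) (m 1) (m 2) (m 3)) \<gamma>' - D (tuple4 \<gamma>' (m 1) (m 2) (m 3)) (m 0) +
    D (tuple4 \<gamma>' (m 0) (m 2) (m 3)) (m 1) - D (tuple4 \<gamma>' (m 0) (m 1) (m 3)) (m 2) + D (tuple4 \<gamma>' (m 0) (m 1) (m 2)) (m 3) = 0"
  proof -
    define V where "V = (\<lambda>_::nat. 0)(0 := \<gamma>', 1 := m 0, 2 := m 1, 3 := m 2, 4 := m 3)"
    have "ext_deriv 4 \<Psi> (\<gamma> t) V = 0"
      using \<gamma> m_tan by (intro closed[rule_format]) (auto simp: V_def)
    then have ext0: "(\<Sum>i\<le>4. (- 1) ^ i * frechet_derivative (\<lambda>y. \<Psi> y (\<lambda>j. if j < i then V j else V (Suc j)))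
        (at (\<gamma> t)) (V i)) = 0"
      by (simp only: ext_deriv_def)
    have seqs: "(\<lambda>j. if j < 0 then V j else V (Suc j)) = tuple4 (m 0) (m 1) (m 2) (m 3)"
      "(\<lambda>j. if j < 1 then V j else V (Suc j)) = tuple4 \<gamma>' (m 1) (m 2) (m 3)"
      "(\<lambda>j. if j < 2 then V j else V (Suc j)) = tuple4 \<gamma>' (m 0) (m 2) (m 3)"
      "(\<lambda>j. if j < 3 then V j else V (Suc j)) = tuple4 \<gamma>' (m 0) (m 1) (m 3)"
      "(\<lambda>j. if j < 4 then V j else V (Suc j)) = tuple4 \<gamma>' (m 0) (m 1) (m 2)"
      by (auto simp: V_def tuple4_def fun_eq_iff)
    have sum5: "(\<Sum>i\<le>4. g i) = g 0 + g 1 + g 2 + g 3 + g (4::nat)" for g :: "nat \<Rightarrow> real"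
      by (simp add: eval_nat_numeral)
    have "V 0 = \<gamma>'" "V 1 = m 0" "V 2 = m 1" "V 3 = m 2" "V 4 = m 3"
      by (simp_all add: V_def)
    then show ?thesis
      using ext0 unfolding sum5 seqs D_def by simp
  qed
  have infin: "D (tuple4 a b c d) (m i) + Q (fund_field (u i) a) b c d + Q a (fund_field (u i) b) c d
     + Q a b (fund_field (u i) c) d + Q a b c (fund_field (u i) d) = 0"
    if "i < 4" "{a, b, c, d} \<subseteq> tan_S3xS4 (\<gamma> t)" for i a b c d
  proof -
    have "D (tuple4 a b c d) (m i) + (\<Sum>j<4. \<Psi> (\<gamma> t) ((tuple4 a b c d)(j := fund_field (u i) (tuple4 a b c d j)))) = 0"
      unfolding D_def m_def
      by (rule invariant_form_infinitesimal[OF ext inv \<gamma>(2)]) (use u that(1) tuple4_tan[OF that(2)] in auto)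
    then show ?thesis
      by (simp add: sum4 Q_def)
  qed
  \<comment> \<open>Invariance along the field \<open>u i\<close>, applied to the tuple that
    accompanies the direction \<open>m i\<close> in \<open>ext0\<close>.\<close>
  have I:
    "D (tuple4 \<gamma>' (m 1) (m 2) (m 3)) (m 0) + Q (fund_field (u 0) \<gamma>') (m 1) (m 2) (m 3) + Q \<gamma>' (fund_field (u 0) (m 1)) (m 2) (m 3)
      + Q \<gamma>' (m 1) (fund_field (u 0) (m 2)) (m 3) + Q \<gamma>' (m 1) (m 2) (fund_field (u 0) (m 3)) = 0"
    "D (tuple4 \<gamma>' (m 0) (m 2) (m 3)) (m 1) + Q (fund_field (u 1) \<gamma>') (m 0) (m 2) (m 3) + Q \<gamma>' (fund_field (u 1) (m 0)) (m 2) (m 3)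
      + Q \<gamma>' (m 0) (fund_field (u 1) (m 2)) (m 3) + Q \<gamma>' (m 0) (m 2) (fund_field (u 1) (m 3)) = 0"
    "D (tuple4 \<gamma>' (m 0) (m 1) (m 3)) (m 2) + Q (fund_field (u 2) \<gamma>') (m 0) (m 1) (m 3) + Q \<gamma>' (fund_field (u 2) (m 0)) (m 1) (m 3)
      + Q \<gamma>' (m 0) (fund_field (u 2) (m 1)) (m 3) + Q \<gamma>' (m 0) (m 1) (fund_field (u 2) (m 3)) = 0"
    "D (tuple4 \<gamma>' (m 0) (m 1) (m 2)) (m 3) + Q (fund_field (u 3) \<gamma>') (m 0) (m 1) (m 2) + Q \<gamma>' (fund_field (u 3) (m 0)) (m 1) (m 2)
      + Q \<gamma>' (m 0) (fund_field (u 3) (m 1)) (m 2) + Q \<gamma>' (m 0) (m 1) (fund_field (u 3) (m 2)) = 0"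
    by (rule infin; simp add: \<gamma>(3) m_tan m_tan[of 1, simplified])+
  have Q_diff: "Q a (x - y) b d = Q a x b d - Q a y b d" "Q a b (x - y) d = Q a b x d - Q a b y d"
     "Q a b d (x - y) = Q a b d x - Q a b d y" for a b d x y
    using alt_form_tuple4[OF alt[OF U(2)], THEN linear_diff] by (simp_all add: Q_def)
  have Q_swap: "Q b a c d = - Q a b c d" "Q a c b d = - Q a b c d" "Q a b d c = - Q a b c d" for a b c d
    unfolding Q_def by (rule alt_form_tuple4_swap[OF alt[OF U(2)]])+
  \<comment> \<open>The arithmetic below treats each value of \<open>Q\<close> as an unknown, so the
    needed reorderings of arguments are supplied as explicit equations.\<close>
  have S: "Q x a b c = - Q a x b c" "Q x a b c = Q a b x c" "Q x a b c = - Q a b c x"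
    "Q d x a b = - Q d a x b" "Q d x a b = Q d a b x" "Q d c x a = - Q d c a x" for x a b c d
    using Q_swap(1)[where a = a and b = x and c = b and d = c] Q_swap(2)[where a = a and b = b and c = x and d = c]
      Q_swap(3)[where a = a and b = b and c = c and d = x] Q_swap(2)[where a = d and b = a and c = x and d = b]
      Q_swap(3)[where a = d and b = a and c = b and d = x] Q_swap(3)[where a = d and b = c and c = a and d = x]
    by linarith+
  have c_m: "c i j = fund_field (u i) (m j) - fund_field (u j) (m i)" for i j
    by (simp add: c_def m_def)
  have "D (tuple4 (m 0) (m 1) (m 2) (m 3)) \<gamma>' + (Q (fund_field (u 0) \<gamma>') (m 1) (m 2) (m 3)
      + Q (m 0) (fund_field (u 1) \<gamma>') (m 2) (m 3) + Q (m 0) (m 1) (fund_field (u 2) \<gamma>') (m 3)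
      + Q (m 0) (m 1) (m 2) (fund_field (u 3) \<gamma>')) =
     - Q \<gamma>' (c 0 1) (m 2) (m 3) - Q \<gamma>' (m 1) (c 0 2) (m 3) - Q \<gamma>' (m 1) (m 2) (c 0 3)
     + Q \<gamma>' (m 0) (c 1 2) (m 3) + Q \<gamma>' (m 0) (m 2) (c 1 3) - Q \<gamma>' (m 0) (m 1) (c 2 3)"
    unfolding c_m Q_diff using ext0 I
      S(1)[of "fund_field (u 1) \<gamma>'" "m 0" "m 2" "m 3"] S(2)[of "fund_field (u 2) \<gamma>'" "m 0" "m 1" "m 3"]
      S(3)[of "fund_field (u 3) \<gamma>'" "m 0" "m 1" "m 2"]
      S(4)[of \<gamma>' "fund_field (u 2) (m 0)" "m 1" "m 3"] S(5)[of \<gamma>' "fund_field (u 3) (m 0)" "m 1" "m 2"]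
      S(6)[of \<gamma>' "m 0" "fund_field (u 3) (m 1)" "m 2"]
    by linarith
  with der show ?thesis
    by (rule DERIV_cong)
qed

section \<open>Half-flat frames\<close>

lemma lie_bracket_cross: "x \<in> su2 \<Longrightarrow> y \<in> su2 \<Longrightarrow> lie_bracket x y = (0, 2 *\<^sub>R cross3 (snd x) (snd y))"
  by (simp add: su2_def lie_bracket_def qmult_def prod_eq_iff cross3_def vec_eq_iff forall_3 inner_commute algebra_simps)

lemma one_to_three: "{1..3::nat} = {1, 2, 3}"
  by auto

lemma su2_basis_bracket:
  assumes "su2_basis T"
  shows "lie_bracket (T 1) (T 2) = 2 *\<^sub>R T 3" "lie_bracket (T 2) (T 3) = 2 *\<^sub>R T 1"
    "lie_bracket (T 3) (T 1) = 2 *\<^sub>R T 2"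
  using assms unfolding su2_basis_def one_to_three by (simp_all add: eps3_def)

lemma su2_basis_su2:
  assumes "su2_basis T" "i \<in> {1..3}"
  shows "T i \<in> su2"
  using assms span_base unfolding su2_basis_def by blast

text \<open>The bracket relations make each basis vector the cross product of the other two in
  cyclic order. That gives orthogonality, and each squared norm is then the product of the other
  two; being positive, all are 1.\<close>

lemma su2_basis_inner:
  assumes T: "su2_basis T" and ij: "i \<in> {1..3}" "j \<in> {1..3}"
  shows "T i \<bullet> T j = (if i = j then 1 else 0)"
proof -
  have "independent (T ` {1..3})"
    using T by (simp add: su2_basis_def)
  then have nz: "T k \<noteq> 0" if "k \<in> {1..3}" for k
    using that dependent_zero by (metis imageI)
  have su: "T 1 \<in> su2" "T 2 \<in> su2" "T 3 \<in> su2"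
    using su2_basis_su2[OF T] by auto
  then have fst0: "fst (T 1) = 0" "fst (T 2) = 0" "fst (T 3) = 0"
    by (auto simp: su2_def)
  have cr: "cross3 (snd (T 1)) (snd (T 2)) = snd (T 3)" "cross3 (snd (T 2)) (snd (T 3)) = snd (T 1)"
    "cross3 (snd (T 3)) (snd (T 1)) = snd (T 2)"
    using su2_basis_bracket[OF T] su by (simp_all add: lie_bracket_cross prod_eq_iff)
  have orth: "snd (T 1) \<bullet> snd (T 2) = 0" "snd (T 2) \<bullet> snd (T 3) = 0" "snd (T 3) \<bullet> snd (T 1) = 0"
    using cr by (metis dot_cross_self inner_commute)+
  define n where "n k = snd (T k) \<bullet> snd (T k)" for k
  have npos: "n 1 > 0" "n 2 > 0" "n 3 > 0"
    using nz[of 1] nz[of 2] nz[of 3] fst0 by (auto simp: n_def prod_eq_iff)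
  have n: "n 3 = n 1 * n 2" "n 1 = n 2 * n 3" "n 2 = n 3 * n 1"
    unfolding n_def using dot_cross[of "snd (T 1)" "snd (T 2)" "snd (T 1)" "snd (T 2)"]
      dot_cross[of "snd (T 2)" "snd (T 3)" "snd (T 2)" "snd (T 3)"]
      dot_cross[of "snd (T 3)" "snd (T 1)" "snd (T 3)" "snd (T 1)"] orth
    unfolding cr by simp_all
  \<comment> \<open>Substituting one norm relation into another shows that each squared norm has
    square 1.\<close>
  have "n 1 * (n 2 * n 2) = n 1" "n 2 * (n 3 * n 3) = n 2" "n 3 * (n 1 * n 1) = n 3"
    by (metis n mult.commute mult.left_commute)+
  then have "n 1 = 1" "n 2 = 1" "n 3 = 1"
    using npos by (auto simp: square_eq_1_iff)
  then show ?thesis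
    using ij orth fst0 unfolding one_to_three n_def by (auto simp: inner_prod_def inner_commute)
qed

lemma T_plus_minus_inner:
  assumes T: "su2_basis T" and ij: "i \<in> {1..3}" "j \<in> {1..3}"
  shows "T_plus T i \<bullet> T_plus T j = (if i = j then 2 else 0)"
    and "T_minus T i \<bullet> T_minus T j = (if i = j then 2 else 0)"
    and "T_plus T i \<bullet> T_minus T j = 0"
    and "T_minus T i \<bullet> T_plus T j = 0"
  using su2_basis_inner[OF assms] by (auto simp: T_plus_def T_minus_def)

text \<open>Pairing the basis expansion of \<open>u\<close> with \<open>b\<close> leaves one term.
  This turns \<open>representation\<close>, through which the coframe is defined, into an inner
  product.\<close>

lemma representation_orthogonal:
  fixes B :: "'a::euclidean_space set"
  assumes "pairwise orthogonal B" "0 \<notin> B" "u \<in> span B" "b \<in> B"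
  shows "representation B u b = (u \<bullet> b) / (b \<bullet> b)"
proof -
  have ind: "independent B"
    using assms(1,2) by (rule pairwise_orthogonal_independent)
  then have fin: "finite B"
    by (rule independent_imp_finite)
  have "u = (\<Sum>c\<in>B. representation B u c *\<^sub>R c)"
    using sum_representation_eq[OF ind assms(3) fin] by simp
  then have "u \<bullet> b = (\<Sum>c\<in>B. representation B u c * (c \<bullet> b))"
    by (metis (no_types, lifting) inner_scaleR_left inner_sum_left sum.cong)
  also have "\<dots> = representation B u b * (b \<bullet> b)"
  proof (subst sum.remove[OF fin assms(4)])
    have "(\<Sum>c\<in>B - {b}. representation B u c * (c \<bullet> b)) = 0"
      using assms(1,4) by (intro sum.neutral) (auto simp: pairwise_def orthogonal_def)
    then show "representation B u b * (b \<bullet> b) + (\<Sum>c\<in>B - {b}. representation B u c * (c \<bullet> b)) =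
        representation B u b * (b \<bullet> b)"
      by simp
  qed
  finally show ?thesis
    using assms(2,4) by (auto simp: field_simps)
qed

lemma T_basis_orthogonal:
  assumes "su2_basis T"
  shows "pairwise orthogonal (T_basis T)" "0 \<notin> T_basis T"
proof -
  show "pairwise orthogonal (T_basis T)"
    unfolding pairwise_def orthogonal_def
  proof (intro ballI impI)
    fix x y assume "x \<in> T_basis T" "y \<in> T_basis T" "x \<noteq> y"
    then show "x \<bullet> y = 0"
      using T_plus_minus_inner[OF assms] unfolding T_basis_def
      by (elim UnE imageE) metis+
  qed
  have "x \<bullet> x = 2" if "x \<in> T_basis T" for x
    using that T_plus_minus_inner(1,2)[OF assms] unfolding T_basis_def
    by (elim UnE imageE) metis+
  then show "0 \<notin> T_basis T"
    by fastforce
qed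

text \<open>Identifies \<open>e\<^sup>4\<close> with \<open>- dt\<close>, \<open>e\<^sup>i\<close> with \<open>2 B\<^sub>i \<eta>\<^sub>i\<^sup>-\<close> and \<open>e\<^bsup>4+i\<^esup>\<close> with \<open>2 A\<^sub>i \<eta>\<^sub>i\<^sup>+\<close>, which turns
  \<open>phi0\<close> into \<open>dt \<and> \<omega> + \<Omega>\<^sub>1\<close>.\<close>

definition half_flat_frame ::
    "(nat \<Rightarrow> quat) \<Rightarrow> (nat \<Rightarrow> real) \<Rightarrow> (nat \<Rightarrow> real) \<Rightarrow> real^7 \<Rightarrow> cyl" where
  "half_flat_frame T a b v =
     (- v $ 4, (v $ 1 / (2 * b 1)) *\<^sub>R T_minus T 1 + (v $ 2 / (2 * b 2)) *\<^sub>R T_minus T 2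
             + (v $ 3 / (2 * b 3)) *\<^sub>R T_minus T 3 + (v $ 5 / (2 * a 1)) *\<^sub>R T_plus T 1
             + (v $ 6 / (2 * a 2)) *\<^sub>R T_plus T 2 + (v $ 7 / (2 * a 3)) *\<^sub>R T_plus T 3)"

lemma half_flat_frame_linear: "linear (half_flat_frame T a b)"
  unfolding linear_iff half_flat_frame_def by (simp add: add_divide_distrib algebra_simps)

text \<open>At the group identity \<open>maurer_cartan\<close> is the identity map, so the coframe
  reads off coefficients in the orthogonal basis \<open>T_basis T\<close>, whose vectors have
  squared norm 2.\<close>

lemma eta_half_flat_frame:
  assumes T: "su2_basis T"
    and "v 0 = half_flat_frame T a b w"
  shows "eta_plus T 1 (t, (qone, qone)) v = w $ 5 / (2 * a 1)"
    "eta_plus T 2 (t, (qone, qone)) v = w $ 6 / (2 * a 2)"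
    "eta_plus T 3 (t, (qone, qone)) v = w $ 7 / (2 * a 3)"
    "eta_minus T 1 (t, (qone, qone)) v = w $ 1 / (2 * b 1)"
    "eta_minus T 2 (t, (qone, qone)) v = w $ 2 / (2 * b 2)"
    "eta_minus T 3 (t, (qone, qone)) v = w $ 3 / (2 * b 3)"
proof -
  define u where "u = snd (half_flat_frame T a b w)"
  have mem: "T_plus T i \<in> T_basis T" "T_minus T i \<in> T_basis T" if "i \<in> {1..3}" for i
    using that by (auto simp: T_basis_def)
  have span: "u \<in> span (T_basis T)"
    unfolding u_def half_flat_frame_def snd_conv by (intro span_add span_scale span_base mem) auto
  have e: "eta_plus T i (t, (qone, qone)) v = (u \<bullet> T_plus T i) / 2"
    "eta_minus T i (t, (qone, qone)) v = (u \<bullet> T_minus T i) / 2" if "i \<in> {1..3}" for i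
    using representation_orthogonal[OF T_basis_orthogonal[OF T] span mem(1)[OF that]]
      representation_orthogonal[OF T_basis_orthogonal[OF T] span mem(2)[OF that]]
      T_plus_minus_inner[OF T that that]
    by (simp_all add: eta_plus_def eta_minus_def maurer_cartan_def assms u_def)
  have "u \<bullet> T_plus T 1 = w $ 5 / a 1" "u \<bullet> T_plus T 2 = w $ 6 / a 2" "u \<bullet> T_plus T 3 = w $ 7 / a 3"
    "u \<bullet> T_minus T 1 = w $ 1 / b 1" "u \<bullet> T_minus T 2 = w $ 2 / b 2" "u \<bullet> T_minus T 3 = w $ 3 / b 3"
    by (simp_all add: u_def half_flat_frame_def inner_add_left T_plus_minus_inner[OF T])
  then show "eta_plus T 1 (t, (qone, qone)) v = w $ 5 / (2 * a 1)"
    "eta_plus T 2 (t, (qone, qone)) v = w $ 6 / (2 * a 2)"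
    "eta_plus T 3 (t, (qone, qone)) v = w $ 7 / (2 * a 3)"
    "eta_minus T 1 (t, (qone, qone)) v = w $ 1 / (2 * b 1)"
    "eta_minus T 2 (t, (qone, qone)) v = w $ 2 / (2 * b 2)"
    "eta_minus T 3 (t, (qone, qone)) v = w $ 3 / (2 * b 3)"
    by (simp_all add: e)
qed

lemma eta_one_form:
  "eta_plus T i z = (\<lambda>v. eta_plus T i z (\<lambda>_. v 0))" "eta_minus T i z = (\<lambda>v. eta_minus T i z (\<lambda>_. v 0))"
  by (simp_all add: eta_plus_def eta_minus_def fun_eq_iff)

lemma omega_AB_eq:
  "omega_AB T A B z v = (\<lambda>x y. 4 * (\<Sum>i\<in>{1..3}. A i (fst z) * B i (fst z) *
      (eta_minus T i z (\<lambda>_. x) * eta_plus T i z (\<lambda>_. y) - eta_minus T i z (\<lambda>_. y) * eta_plus T i z (\<lambda>_. x))))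
      (v 0) (v 1)"
  unfolding omega_AB_def
  by (subst eta_one_form(1), subst eta_one_form(2), subst wedge_1_1) (rule refl)

text \<open>Solving for the coordinates of \<open>w\<close> in terms of the coframe values turns
  both sides into the same polynomial in these values.\<close>

lemma phi_AB_half_flat_frame:
  assumes T: "su2_basis T" and nz: "\<forall>i\<in>{1..3}. A i t \<noteq> 0 \<and> B i t \<noteq> 0"
    and v: "\<And>i. i < 3 \<Longrightarrow> v i = half_flat_frame T (\<lambda>i. A i t) (\<lambda>i. B i t) (w i)"
  shows "phi_AB T A B (t, (qone, qone)) v = phi0 w"
proof -
  let ?z = "(t, (qone, qone))"
  have nz': "A 1 t \<noteq> 0" "A 2 t \<noteq> 0" "A 3 t \<noteq> 0" "B 1 t \<noteq> 0" "B 2 t \<noteq> 0" "B 3 t \<noteq> 0"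
    using nz by auto
  have w: "w j $ 5 = 2 * A 1 t * eta_plus T 1 ?z (\<lambda>_. v j)" "w j $ 6 = 2 * A 2 t * eta_plus T 2 ?z (\<lambda>_. v j)"
    "w j $ 7 = 2 * A 3 t * eta_plus T 3 ?z (\<lambda>_. v j)" "w j $ 1 = 2 * B 1 t * eta_minus T 1 ?z (\<lambda>_. v j)"
    "w j $ 2 = 2 * B 2 t * eta_minus T 2 ?z (\<lambda>_. v j)" "w j $ 3 = 2 * B 3 t * eta_minus T 3 ?z (\<lambda>_. v j)"
    "w j $ 4 = - fst (v j)"
    if "j < 3" for j
    using eta_half_flat_frame[OF T, of "\<lambda>_. v j", OF v[OF that]] nz' v[OF that]
    by (simp_all add: half_flat_frame_def)
  let ?p = "\<lambda>i x. eta_plus T i ?z (\<lambda>_. x)" and ?m = "\<lambda>i x. eta_minus T i ?z (\<lambda>_. x)"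
  have w3: "wedge3 (eta_plus T i ?z) (eta_plus T j ?z) (eta_minus T k ?z) v =
     ?p i (v 0) * (?p j (v 1) * ?m k (v 2) - ?p j (v 2) * ?m k (v 1))
   - ?p i (v 1) * (?p j (v 0) * ?m k (v 2) - ?p j (v 2) * ?m k (v 0))
   + ?p i (v 2) * (?p j (v 0) * ?m k (v 1) - ?p j (v 1) * ?m k (v 0))"
   "wedge3 (eta_minus T i ?z) (eta_minus T j ?z) (eta_minus T k ?z) v =
     ?m i (v 0) * (?m j (v 1) * ?m k (v 2) - ?m j (v 2) * ?m k (v 1))
   - ?m i (v 1) * (?m j (v 0) * ?m k (v 2) - ?m j (v 2) * ?m k (v 0))
   + ?m i (v 2) * (?m j (v 0) * ?m k (v 1) - ?m j (v 1) * ?m k (v 0))"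
    for i j k
    using wedge3_1forms[of "?p i" "?p j" "?m k" v] wedge3_1forms[of "?m i" "?m j" "?m k" v]
    by (simp_all only: eta_one_form(1)[symmetric] eta_one_form(2)[symmetric])
  have "Omega1_AB T A B ?z v = e3form 1 2 3 w - e3form 1 6 7 w - e3form 5 2 7 w - e3form 5 6 3 w"
    unfolding Omega1_AB_def w3 e3form_eq fst_conv one_to_three
    by (simp add: eps3_def w) (simp add: algebra_simps)
  moreover have "wedge 1 2 dt_form (omega_AB T A B ?z) v = - e3form 4 1 5 w - e3form 4 2 6 w - e3form 4 3 7 w"
    using wedge_1_2[of fst "\<lambda>x y. 4 * (\<Sum>i\<in>{1..3}. A i t * B i t * (?m i x * ?p i y - ?m i y * ?p i x))" v]
    unfolding dt_form_def[abs_def] omega_AB_eq[abs_def] e3form_eq fst_conv one_to_three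
    by (simp add: w) (simp add: algebra_simps)
  ultimately show ?thesis
    by (simp add: phi_AB_def phi0_def)
qed

lemma phi0_nondegenerate:
  assumes "\<And>a b. phi0 ((\<lambda>_. 0)(0 := v, 1 := a, 2 := b)) = 0"
  shows "v = 0"
proof -
  have "phi0 ((\<lambda>_. 0)(0 := v, 1 := axis i 1, 2 := axis j 1)) = 0" for i j
    by (rule assms)
  \<comment> \<open>Each pair of indices is completed to a triple of \<open>phi0\<close> by exactly
    one index; the completions are 1, ..., 7 in this order.\<close>
  from this[of 2 3] this[of 3 1] this[of 1 2] this[of 1 5] this[of 2 7] this[of 7 1] this[of 1 6]
  have "v $ 1 = 0" "v $ 2 = 0" "v $ 3 = 0" "v $ 4 = 0" "v $ 5 = 0" "v $ 6 = 0" "v $ 7 = 0"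
    unfolding phi0_def e3form_eq by (simp_all add: axis_def)
  then have "v $ of_nat (Suc i) = 0" if "i < 7" for i
  proof -
    have "i \<in> {0,1,2,3,4,5,6}"
      using that by auto
    then show ?thesis
      using \<open>v $ 1 = 0\<close> \<open>v $ 2 = 0\<close> \<open>v $ 3 = 0\<close> \<open>v $ 4 = 0\<close> \<open>v $ 5 = 0\<close> \<open>v $ 6 = 0\<close> \<open>v $ 7 = 0\<close>
      by (elim insertE emptyE) simp_all
  qed
  moreover have "\<exists>i<7. k = of_nat (Suc i)" for k :: 7
  proof -
    have "k \<in> of_nat ` Suc ` {..<7}"
      using range_of_nat_Suc_7 by simp
    then show ?thesis by auto
  qed
  ultimately have "v $ k = 0" for k
    by metis
  then show ?thesis
    by (simp add: vec_eq_iff)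
qed

section \<open>Sign arguments\<close>

lemma continuous_nonzero_sgn_constant:
  fixes f :: "real \<Rightarrow> real"
  assumes "continuous_on S f" "connected S" "\<And>t. t \<in> S \<Longrightarrow> f t \<noteq> 0" "x \<in> S" "y \<in> S"
  shows "sgn (f x) = sgn (f y)"
proof -
  have conn: "connected (f ` S)"
    using assms by (intro connected_continuous_image)
  have "0 \<notin> f ` S"
    using assms by force
  then have "\<not> (f u \<le> 0 \<and> 0 \<le> f v)" if "u \<in> S" "v \<in> S" for u v
    using connected_contains_Icc[OF conn, of "f u" "f v"] that by auto
  then have "\<not> (f x \<le> 0 \<and> 0 \<le> f y)" "\<not> (f y \<le> 0 \<and> 0 \<le> f x)"
    using assms by blast+
  then show ?thesis
    by (auto simp: sgn_if)
qed

text \<open>After multiplication by \<open>a * b * c\<close> the terms become \<open>P\<close>,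
  which is positive, and \<open>X\<close>, \<open>Y\<close>, \<open>Z\<close> with the signs of
  \<open>p\<close>, \<open>q\<close>, \<open>r\<close>. As \<open>p * q * r\<close> is a nonzero
  square, none or exactly two of these are negative. In the first case the sum is
  \<open>3 * P + X + Y + Z\<close>. For \<open>p > 0\<close> and \<open>q\<close>, \<open>r\<close>
  negative it is \<open>- P - 3 * X + Y + Z\<close>, with four negative terms; the remaining cases
  are cyclic.\<close>

lemma half_flat_sign_sum_nonzero:
  fixes a b c x y z :: real
  assumes "a \<noteq> 0" "b \<noteq> 0" "c \<noteq> 0" "x \<noteq> 0" "y \<noteq> 0" "z \<noteq> 0"
  shows "sgn (a * x * b * y) * (a * b * c + a * y * z + b * z * x - c * x * y)
       + sgn (b * y * c * z) * (a * b * c + b * z * x + c * x * y - a * y * z)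
       + sgn (c * z * a * x) * (a * b * c + c * x * y + a * y * z - b * z * x) \<noteq> 0" (is "?S \<noteq> 0")
proof -
  define p q r where "p = b * y * c * z" and "q = c * z * a * x" and "r = a * x * b * y"
  define P X Y Z where "P = (a * b * c)\<^sup>2" and "X = a\<^sup>2 * p" and "Y = b\<^sup>2 * q" and "Z = c\<^sup>2 * r"
  have eq: "a * b * c * ?S = sgn r * (P + X + Y - Z) + sgn p * (P + Y + Z - X) + sgn q * (P + Z + X - Y)"
    unfolding P_def X_def Y_def Z_def p_def q_def r_def by (simp add: algebra_simps power2_eq_square)
  have "P > 0"
    using assms by (simp add: P_def)
  have X: "0 < X \<longleftrightarrow> 0 < p" "X < 0 \<longleftrightarrow> p < 0" and Y: "0 < Y \<longleftrightarrow> 0 < q" "Y < 0 \<longleftrightarrow> q < 0"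
    and Z: "0 < Z \<longleftrightarrow> 0 < r" "Z < 0 \<longleftrightarrow> r < 0"
    using assms by (simp_all add: X_def Y_def Z_def zero_less_mult_iff mult_less_0_iff)
  have "p * q * r = (a * b * c * x * y * z)\<^sup>2"
    by (simp add: p_def q_def r_def power2_eq_square)
  then have "p * q * r > 0"
    using assms by simp
  then consider "p > 0" "q > 0" "r > 0" | "p > 0" "q < 0" "r < 0" | "p < 0" "q > 0" "r < 0"
    | "p < 0" "q < 0" "r > 0"
    by (auto simp: zero_less_mult_iff mult_less_0_iff)
  then have "a * b * c * ?S \<noteq> 0"
  proof cases
    case 1
    with X Y Z have "X > 0" "Y > 0" "Z > 0" by simp_all
    with 1 eq \<open>P > 0\<close> show ?thesis by simp
  next
    case 2
    with X Y Z have "X > 0" "Y < 0" "Z < 0" by simp_all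
    with 2 eq \<open>P > 0\<close> show ?thesis by simp
  next
    case 3
    with X Y Z have "X < 0" "Y > 0" "Z < 0" by simp_all
    with 3 eq \<open>P > 0\<close> show ?thesis by simp
  next
    case 4
    with X Y Z have "X < 0" "Y < 0" "Z > 0" by simp_all
    with 4 eq \<open>P > 0\<close> show ?thesis by simp
  qed
  then show ?thesis by simp
qed

section \<open>Adapted frames along the geodesic\<close>

lemma norm_constant_orthogonal_derivative:
  fixes f :: "real \<Rightarrow> 'a::real_inner"
  assumes "(f has_vector_derivative f') (at t)" "open I" "t \<in> I" "\<And>s. s \<in> I \<Longrightarrow> f s \<bullet> f s = c"
  shows "f t \<bullet> f' = 0"
proof -
  have "((\<lambda>s. f s \<bullet> f s) has_vector_derivative f t \<bullet> f' + f' \<bullet> f t) (at t)"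
    using has_derivative_inner[OF assms(1)[unfolded has_vector_derivative_def] assms(1)[unfolded has_vector_derivative_def]]
    by (simp add: has_vector_derivative_def algebra_simps)
  moreover have "((\<lambda>s. f s \<bullet> f s) has_vector_derivative 0) (at t)"
    by (rule has_vector_derivative_transform_within_open[OF has_vector_derivative_const assms(2,3)])
      (use assms(4) in simp)
  ultimately have "f t \<bullet> f' + f' \<bullet> f t = 0"
    by (rule vector_derivative_unique_at)
  then show ?thesis
    by (simp add: inner_commute)
qed

lemma S3xS4_curve_tangent:
  assumes "(\<gamma> has_vector_derivative \<gamma>') (at t)" "open I" "t \<in> I" "\<gamma> ` I \<subseteq> S3xS4"
  shows "\<gamma>' \<in> tan_S3xS4 (\<gamma> t)"
proof -
  have S: "fst (\<gamma> s) \<bullet> fst (\<gamma> s) = 1" "snd (\<gamma> s) \<bullet> snd (\<gamma> s) = 1" if "s \<in> I" for s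
    using assms(4) that S3xS4_iff[of "\<gamma> s"] by blast+
  have "fst (\<gamma> t) \<bullet> fst \<gamma>' = 0"
    by (rule norm_constant_orthogonal_derivative[where c = 1, OF bounded_linear.has_vector_derivative[OF bounded_linear_fst assms(1)] assms(2,3)])
      (rule S)
  moreover have "snd (\<gamma> t) \<bullet> snd \<gamma>' = 0"
    by (rule norm_constant_orthogonal_derivative[where c = 1, OF bounded_linear.has_vector_derivative[OF bounded_linear_snd assms(1)] assms(2,3)])
      (rule S)
  ultimately show ?thesis
    by (simp add: tan_S3xS4_def)
qed

text \<open>At the group identity the differential of the orbit map sends the time direction to
  \<gamma>' and the group directions to fundamental vectors.\<close>

lemma pullback_cylinder:
  assumes "(\<gamma> has_vector_derivative \<gamma>') (at t)"
  shows "pullback (\<lambda>(s, b). act b (\<gamma> s)) \<phi> (t, (qone, qone)) v =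
    \<phi> (\<gamma> t) (\<lambda>i. fst (v i) *\<^sub>R \<gamma>' + fund_field (snd (v i)) (\<gamma> t))"
proof -
  have 1: "((\<lambda>z. \<gamma> (fst z)) has_derivative (\<lambda>h. fst h *\<^sub>R \<gamma>')) (at (t, qone, qone))"
    using has_derivative_compose[of fst fst "(t, qone, qone)" UNIV \<gamma> "\<lambda>h. h *\<^sub>R \<gamma>'"] assms
    by (simp add: has_vector_derivative_def has_derivative_fst)
  have "((\<lambda>z. act (snd z) (\<gamma> (fst z))) has_derivative (\<lambda>h. fst h *\<^sub>R \<gamma>' + fund_field (snd h) (\<gamma> (fst (t, qone, qone)))))
     (at (t, qone, qone))"
    by (rule act_has_derivative[OF has_derivative_snd[OF has_derivative_ident] 1]) simp
  then have "frechet_derivative (\<lambda>(s, b). act b (\<gamma> s)) (at (t, qone, qone)) =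
      (\<lambda>h. fst h *\<^sub>R \<gamma>' + fund_field (snd h) (\<gamma> t))"
    by (simp add: case_prod_beta' frechet_derivative_at[symmetric])
  then show ?thesis
    by (simp add: pullback_def act_def)
qed

lemma half_flat_frame_su2:
  assumes "su2_basis T"
  shows "fst (snd (half_flat_frame T a b v)) \<in> su2" "snd (snd (half_flat_frame T a b v)) \<in> su2"
  using su2_basis_su2[OF assms, of 1] su2_basis_su2[OF assms, of 2] su2_basis_su2[OF assms, of 3]
  by (simp_all add: half_flat_frame_def T_plus_def T_minus_def su2_def)

text \<open>\<open>L\<close> is the frame of the cylinder followed by the differential of the orbit
  map, so it pulls \<phi> back to \<open>phi0\<close>. Injectivity comes from the nondegeneracy of
  \<open>phi0\<close>, surjectivity onto the tangent space from a dimension count.\<close>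

lemma adapted_half_flat_frame:
  assumes T: "su2_basis T" and nz: "\<forall>i\<in>{1..3}. A i t \<noteq> 0 \<and> B i t \<noteq> 0"
    and G2: "G2_structure \<phi>"
    and \<gamma>: "(\<gamma> has_vector_derivative \<gamma>') (at t)" "\<gamma> t \<in> S3xS4" "\<gamma>' \<in> tan_S3xS4 (\<gamma> t)"
    and pb: "\<forall>v. (\<forall>i<3. snd (v i) \<in> tan_G (qone, qone)) \<longrightarrow>
       pullback (\<lambda>(s, b). act b (\<gamma> s)) \<phi> (t, (qone, qone)) v = phi_AB T A B (t, (qone, qone)) v"
  defines "K \<equiv> half_flat_frame T (\<lambda>i. A i t) (\<lambda>i. B i t)"
  defines "L \<equiv> \<lambda>v. fst (K v) *\<^sub>R \<gamma>' + fund_field (snd (K v)) (\<gamma> t)"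
  shows "adapted \<phi> (\<gamma> t) L"
proof -
  have phi: "\<phi> (\<gamma> t) (\<lambda>i. L (v i)) = phi0 v" for v
  proof -
    have "snd (K (v i)) \<in> tan_G (qone, qone)" for i
      using half_flat_frame_su2[OF T] by (simp add: tan_G_def K_def qone_def su2_def inner_prod_def)
    then have "pullback (\<lambda>(s, b). act b (\<gamma> s)) \<phi> (t, (qone, qone)) (\<lambda>i. K (v i)) =
        phi_AB T A B (t, (qone, qone)) (\<lambda>i. K (v i))"
      using pb[rule_format, of "\<lambda>i. K (v i)"] by blast
    also have "\<dots> = phi0 v"
      by (intro phi_AB_half_flat_frame[where A = A and B = B and t = t, OF T nz]) (auto simp: K_def)
    finally show ?thesis
      by (simp add: pullback_cylinder[OF \<gamma>(1)] L_def)
  qed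
  have "linear K"
    unfolding K_def by (rule half_flat_frame_linear)
  then have lin: "linear L"
    unfolding linear_iff L_def by (simp add: linear_add[OF fund_field_linear_left] linear_scale[OF fund_field_linear_left] algebra_simps)
  have tan: "L v \<in> tan_S3xS4 (\<gamma> t)" for v
  proof -
    have "fund_field (snd (K v)) (\<gamma> t) \<in> tan_S3xS4 (\<gamma> t)"
      unfolding K_def by (intro fund_field_tan half_flat_frame_su2[OF T])
    then show ?thesis
      using \<gamma>(3) by (simp add: L_def tan_S3xS4_def inner_add_right)
  qed
  have inj: "inj L"
    unfolding linear_injective_0[OF lin]
  proof (intro allI impI)
    fix v assume "L v = 0"
    \<comment> \<open>Multilinearity on tangent vectors is available through a smooth extension: a
      kernel vector of \<open>L\<close> puts 0 into the first slot, so \<open>phi0\<close> vanishes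
      on it.\<close>
    obtain U \<Psi> where "extends_form 3 \<phi> U \<Psi>"
      using G2 by (auto simp: G2_structure_def smooth_form_def)
    then have alt: "alt_form 3 (\<Psi> (\<gamma> t))"
      and eq: "\<And>w. (\<And>i. w i \<in> tan_S3xS4 (\<gamma> t)) \<Longrightarrow> \<phi> (\<gamma> t) w = \<Psi> (\<gamma> t) w"
      using \<gamma>(2) by (auto simp: extends_form_def)
    show "v = 0"
    proof (rule phi0_nondegenerate)
      fix a b
      let ?w = "(\<lambda>_::nat. 0)(0 := v, 1 := a, 2 := b)"
      have "phi0 ?w = \<Psi> (\<gamma> t) (\<lambda>i. L (?w i))"
        unfolding phi[symmetric] using tan by (rule eq)
      also have "(\<lambda>i. L (?w i)) = (\<lambda>i. L (?w i))(0 := 0)"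
        using \<open>L v = 0\<close> by auto
      also have "\<Psi> (\<gamma> t) \<dots> = 0"
        using linear_0[OF alt_form_linear[OF alt, of 0]] by simp
      finally show "phi0 ?w = 0" .
    qed
  qed
  \<comment> \<open>Any adapted map has the tangent space as its range, and like \<open>L\<close> it
    is injective on the same space, so the dimensions agree.\<close>
  obtain L' where L': "adapted \<phi> (\<gamma> t) L'"
    using G2 \<gamma>(2) unfolding G2_structure_def by blast
  have "range L = range L'"
  proof (rule subspace_dim_equal)
    have L'_lin: "linear L'" "inj L'"
      using L' by (simp_all add: adapted_def)
    show "subspace (range L)" "subspace (range L')"
      using linear_subspace_image[OF lin subspace_UNIV] linear_subspace_image[OF L'_lin(1) subspace_UNIV] .
    show "range L \<subseteq> range L'"
      using tan L' by (auto simp: adapted_def)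
    show "dim (range L') \<le> dim (range L)"
      using dim_image_eq[OF lin, of UNIV] dim_image_eq[OF L'_lin(1), of UNIV] inj L'_lin(2) by simp
  qed
  then show ?thesis
    using lin inj phi L' by (simp add: adapted_def)
qed

text \<open>The fields and \<gamma>' are multiples of the images of basis vectors under one adapted
  frame, so the values are those of the model form times the scale factors.\<close>

lemma hodge_star_half_flat_frame:
  assumes T: "su2_basis T" and nz: "\<forall>i\<in>{1..3}. A i t \<noteq> 0 \<and> B i t \<noteq> 0"
    and G2: "G2_structure \<phi>"
    and star: "is_hodge_star \<phi> 3 \<phi> \<psi>" and ext: "extends_form 4 \<psi> U \<Psi>"
    and \<gamma>: "(\<gamma> has_vector_derivative \<gamma>') (at t)" "\<gamma> t \<in> S3xS4" "\<gamma>' \<in> tan_S3xS4 (\<gamma> t)"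
    and pb: "\<forall>v. (\<forall>i<3. snd (v i) \<in> tan_G (qone, qone)) \<longrightarrow>
       pullback (\<lambda>(s, b). act b (\<gamma> s)) \<phi> (t, (qone, qone)) v = phi_AB T A B (t, (qone, qone)) v"
  defines "m \<equiv> \<lambda>i. fund_field (T_minus T i) (\<gamma> t)" and "p \<equiv> \<lambda>i. fund_field (T_plus T i) (\<gamma> t)"
    and "Q \<equiv> \<lambda>a b c d. \<Psi> (\<gamma> t) (tuple4 a b c d)"
  shows "Q (m 1) (m 2) (p 1) (p 2) = - 16 * (A 1 t * B 1 t * A 2 t * B 2 t)"
    and "Q (m 2) (m 3) (p 2) (p 3) = - 16 * (A 2 t * B 2 t * A 3 t * B 3 t)"
    and "Q (m 3) (m 1) (p 3) (p 1) = - 16 * (A 3 t * B 3 t * A 1 t * B 1 t)"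
    and "Q \<gamma>' (p 1) (p 2) (p 3) = 8 * (A 1 t * A 2 t * A 3 t)"
    and "Q \<gamma>' (m 1) (m 2) (p 3) = - 8 * (B 1 t * B 2 t * A 3 t)"
    and "Q \<gamma>' (m 2) (m 3) (p 1) = - 8 * (B 2 t * B 3 t * A 1 t)"
    and "Q \<gamma>' (m 3) (m 1) (p 2) = - 8 * (B 3 t * B 1 t * A 2 t)"
proof -
  define K where "K = half_flat_frame T (\<lambda>i. A i t) (\<lambda>i. B i t)"
  define L where "L v = fst (K v) *\<^sub>R \<gamma>' + fund_field (snd (K v)) (\<gamma> t)" for v
  have L: "adapted \<phi> (\<gamma> t) L"
    using adapted_half_flat_frame[OF T nz G2 \<gamma> pb] unfolding K_def L_def[abs_def] by blast
  have alt: "alt_form 4 (\<Psi> (\<gamma> t))"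
      and eq: "\<And>w. (\<And>i. w i \<in> tan_S3xS4 (\<gamma> t)) \<Longrightarrow> \<psi> (\<gamma> t) w = \<Psi> (\<gamma> t) w"
    using \<gamma>(2) ext by (auto simp: extends_form_def)
  have QL: "Q (L a) (L b) (L c) (L d) = hodge0 3 phi0 (tuple4 a b c d)" for a b c d
  proof -
    have "L 0 = 0" and tan: "\<And>v. L v \<in> tan_S3xS4 (\<gamma> t)"
      using L by (auto simp: adapted_def linear_0)
    then have "tuple4 (L a) (L b) (L c) (L d) = (\<lambda>i. L (tuple4 a b c d i))"
      by (auto simp: tuple4_def fun_eq_iff)
    then show ?thesis
      using eq[of "\<lambda>i. L (tuple4 a b c d i)"] tan hodge_star_adapted[OF star \<gamma>(2) L, of "tuple4 a b c d"]
      by (simp add: Q_def)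
  qed
  have nz': "A 1 t \<noteq> 0" "A 2 t \<noteq> 0" "A 3 t \<noteq> 0" "B 1 t \<noteq> 0" "B 2 t \<noteq> 0" "B 3 t \<noteq> 0"
    using nz by auto
  \<comment> \<open>The factor -1 reflects \<open>e\<^sup>4 = - dt\<close>; the factors
    \<open>2 * A\<close> and \<open>2 * B\<close> undo the normalisation in
    \<open>half_flat_frame\<close>.\<close>
  have frame: "\<gamma>' = (-1) *\<^sub>R L (axis 4 1)"
    "m 1 = (2 * B 1 t) *\<^sub>R L (axis 1 1)" "m 2 = (2 * B 2 t) *\<^sub>R L (axis 2 1)" "m 3 = (2 * B 3 t) *\<^sub>R L (axis 3 1)"
    "p 1 = (2 * A 1 t) *\<^sub>R L (axis 5 1)" "p 2 = (2 * A 2 t) *\<^sub>R L (axis 6 1)" "p 3 = (2 * A 3 t) *\<^sub>R L (axis 7 1)"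
    using nz' by (simp_all add: L_def K_def half_flat_frame_def axis_def m_def p_def
        linear_scale[OF fund_field_linear_left] linear_0[OF fund_field_linear_left])
  have Q_scale: "Q (r *\<^sub>R a) b c d = r * Q a b c d" "Q a (r *\<^sub>R b) c d = r * Q a b c d"
    "Q a b (r *\<^sub>R c) d = r * Q a b c d" "Q a b c (r *\<^sub>R d) = r * Q a b c d" for r a b c d
    using alt_form_tuple4[OF alt, THEN linear_scale] by (simp_all add: Q_def)
  show "Q (m 1) (m 2) (p 1) (p 2) = - 16 * (A 1 t * B 1 t * A 2 t * B 2 t)"
    "Q (m 2) (m 3) (p 2) (p 3) = - 16 * (A 2 t * B 2 t * A 3 t * B 3 t)"
    "Q (m 3) (m 1) (p 3) (p 1) = - 16 * (A 3 t * B 3 t * A 1 t * B 1 t)"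
    unfolding frame Q_scale QL hodge0_phi0_values by simp_all
  show "Q \<gamma>' (p 1) (p 2) (p 3) = 8 * (A 1 t * A 2 t * A 3 t)"
    "Q \<gamma>' (m 1) (m 2) (p 3) = - 8 * (B 1 t * B 2 t * A 3 t)"
    "Q \<gamma>' (m 2) (m 3) (p 1) = - 8 * (B 2 t * B 3 t * A 1 t)"
    "Q \<gamma>' (m 3) (m 1) (p 2) = - 8 * (B 3 t * B 1 t * A 2 t)"
    by (subst frame(1), unfold frame(2-) Q_scale QL hodge0_phi0_values, simp)+
qed

text \<open>Of the six brackets among \<open>T\<^sub>i\<^sup>-\<close>,
  \<open>T\<^sub>j\<^sup>-\<close>, \<open>T\<^sub>i\<^sup>+\<close>,
  \<open>T\<^sub>j\<^sup>+\<close>, the two with equal index vanish. Equal superscripts give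
  \<open>2 T\<^sub>k\<^sup>+\<close>; the two mixed ones give \<open>T\<^sub>k\<^sup>-\<close> with
  factor 2 or -2.\<close>

lemma coclosed_half_flat_derivative:
  assumes T: "su2_basis T" and ijk: "i \<in> {1..3}" "j \<in> {1..3}" "k \<in> {1..3}"
      "lie_bracket (T i) (T j) = 2 *\<^sub>R T k"
    and ext: "extends_form 4 \<psi> U \<Psi>"
    and closed: "\<forall>x\<in>S3xS4. \<forall>v. (\<forall>i\<le>4. v i \<in> tan_S3xS4 x) \<longrightarrow> ext_deriv 4 \<Psi> x v = 0"
    and inv: "\<forall>a\<in>G. \<forall>x\<in>S3xS4. \<forall>v. (\<forall>i. v i \<in> tan_S3xS4 x) \<longrightarrow>
          \<psi> (act a x) (\<lambda>i. act a (v i)) = \<psi> x v"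
    and \<gamma>: "(\<gamma> has_vector_derivative \<gamma>') (at t)" "\<gamma> t \<in> S3xS4" "\<gamma>' \<in> tan_S3xS4 (\<gamma> t)"
  defines "m \<equiv> \<lambda>i. fund_field (T_minus T i) (\<gamma> t)" and "p \<equiv> \<lambda>i. fund_field (T_plus T i) (\<gamma> t)"
    and "Q \<equiv> \<lambda>a b c d. \<Psi> (\<gamma> t) (tuple4 a b c d)"
  shows "((\<lambda>s. \<Psi> (\<gamma> s) (tuple4 (fund_field (T_minus T i) (\<gamma> s)) (fund_field (T_minus T j) (\<gamma> s))
                         (fund_field (T_plus T i) (\<gamma> s)) (fund_field (T_plus T j) (\<gamma> s)))) has_real_derivative
     - 2 * Q \<gamma>' (p i) (p j) (p k) + 2 * Q \<gamma>' (m j) (m k) (p i) + 2 * Q \<gamma>' (m k) (m i) (p j)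
     - 2 * Q \<gamma>' (m i) (m j) (p k)) (at t)"
proof -
  define u where "u = (\<lambda>n::nat. if n = 0 then T_minus T i else if n = 1 then T_minus T j
      else if n = 2 then T_plus T i else T_plus T j)"
  have u_simps: "u 0 = T_minus T i" "u 1 = T_minus T j" "u 2 = T_plus T i" "u 3 = T_plus T j"
    by (simp_all add: u_def)
  have su: "T i \<in> su2" "T j \<in> su2" "norm (T i) = 1" "norm (T j) = 1"
    using su2_basis_su2[OF T] su2_basis_inner[OF T] ijk by (simp_all add: norm_eq_1)
  then have "fst (u n) \<in> su2 \<and> snd (u n) \<in> su2 \<and> norm (fst (u n)) = 1 \<and> norm (snd (u n)) = 1" for n
    by (simp add: u_def T_minus_def T_plus_def su2_def)
  then have u: "\<forall>n<4. fst (u n) \<in> su2 \<and> snd (u n) \<in> su2 \<and> norm (fst (u n)) = 1 \<and> norm (snd (u n)) = 1"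
    by blast
  have alt: "alt_form 4 (\<Psi> (\<gamma> t))"
    using \<gamma>(2) ext by (auto simp: extends_form_def)
  have Q_scale: "Q a (r *\<^sub>R b) c d = r * Q a b c d"
    "Q a b (r *\<^sub>R c) d = r * Q a b c d" "Q a b c (r *\<^sub>R d) = r * Q a b c d"
    and Q_0: "Q a 0 c d = 0" "Q a b 0 d = 0" "Q a b c 0 = 0" for r a b c d
    using alt_form_tuple4[OF alt, THEN linear_scale] alt_form_tuple4[OF alt, THEN linear_0] by (simp_all add: Q_def)
  have Q_swap: "Q a c b d = - Q a b c d" "Q a b d c = - Q a b c d" for a b c d
    unfolding Q_def by (rule alt_form_tuple4_swap[OF alt])+
  have lb: "lie_bracket (- x) y = - lie_bracket x y" "lie_bracket x (- y) = - lie_bracket x y"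
      "lie_bracket y x = - lie_bracket x y" "lie_bracket x x = 0" for x y
    by (simp_all add: lie_bracket_def qmult.minus_left qmult.minus_right)
  have c: "fund_field (u 0) (fund_field (u 1) (\<gamma> t)) - fund_field (u 1) (fund_field (u 0) (\<gamma> t)) = 2 *\<^sub>R p k"
    "fund_field (u 0) (fund_field (u 2) (\<gamma> t)) - fund_field (u 2) (fund_field (u 0) (\<gamma> t)) = 0"
    "fund_field (u 0) (fund_field (u 3) (\<gamma> t)) - fund_field (u 3) (fund_field (u 0) (\<gamma> t)) = 2 *\<^sub>R m k"
    "fund_field (u 1) (fund_field (u 2) (\<gamma> t)) - fund_field (u 2) (fund_field (u 1) (\<gamma> t)) = (- 2) *\<^sub>R m k"
    "fund_field (u 1) (fund_field (u 3) (\<gamma> t)) - fund_field (u 3) (fund_field (u 1) (\<gamma> t)) = 0"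
    "fund_field (u 2) (fund_field (u 3) (\<gamma> t)) - fund_field (u 3) (fund_field (u 2) (\<gamma> t)) = 2 *\<^sub>R p k"
    unfolding fund_field_commutator u_simps p_def m_def linear_scale[OF fund_field_linear_left, symmetric]
    by (simp_all add: T_plus_def T_minus_def lb(1,2,4) lb(3)[of "T j" "T i"] ijk(4) linear_0[OF fund_field_linear_left] flip: zero_prod_def)
  have "((\<lambda>s. \<Psi> (\<gamma> s) (tuple4 (fund_field (u 0) (\<gamma> s)) (fund_field (u 1) (\<gamma> s)) (fund_field (u 2) (\<gamma> s)) (fund_field (u 3) (\<gamma> s))))
    has_real_derivative
     - Q \<gamma>' (2 *\<^sub>R p k) (p i) (p j) - Q \<gamma>' (m j) 0 (p j) - Q \<gamma>' (m j) (p i) (2 *\<^sub>R m k)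
     + Q \<gamma>' (m i) ((- 2) *\<^sub>R m k) (p j) + Q \<gamma>' (m i) (p i) 0 - Q \<gamma>' (m i) (m j) (2 *\<^sub>R p k)) (at t)"
    using closed_form_fund_field_derivative[OF ext closed inv \<gamma> u] unfolding c by (simp only: u_simps m_def p_def Q_def)
  then show ?thesis
    unfolding u_simps Q_scale Q_0
    by (rule DERIV_cong)
      (use Q_swap(1)[of \<gamma>' "p i" "p k" "p j"] Q_swap(2)[of \<gamma>' "p i" "p j" "p k"] Q_swap(2)[of \<gamma>' "m j" "p i" "m k"]
        Q_swap(1)[of \<gamma>' "m i" "m k" "p j"] Q_swap(1)[of \<gamma>' "m k" "m i" "p j"] Q_swap(1)[of \<gamma>' "p k" "p i" "p j"]
        Q_swap(2)[of \<gamma>' "p i" "p k" "p j"] Q_swap(2)[of \<gamma>' "m j" "m k" "p i"] in linarith)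
qed

section \<open>The contradiction at a critical point\<close>

theorem proposition4p11:
  fixes T :: "nat \<Rightarrow> quat"
  assumes "su2_basis T"
  shows "\<not> (\<exists>\<phi>. G2_structure \<phi> \<and> invariant_form 3 \<phi> \<and> coclosed \<phi> \<and>
                constructed_from_half_flat T \<phi>)"
proof
  assume "\<exists>\<phi>. G2_structure \<phi> \<and> invariant_form 3 \<phi> \<and> coclosed \<phi> \<and> constructed_from_half_flat T \<phi>"
  then obtain \<phi> where G2: "G2_structure \<phi>" and inv: "invariant_form 3 \<phi>" and "coclosed \<phi>"
    and "constructed_from_half_flat T \<phi>"
    by blast
  then obtain \<psi> U \<Psi> g \<gamma> A B where star: "is_hodge_star \<phi> 3 \<phi> \<psi>" and ext: "extends_form 4 \<psi> U \<Psi>"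
    and closed: "\<forall>x\<in>S3xS4. \<forall>v. (\<forall>i\<le>4. v i \<in> tan_S3xS4 x) \<longrightarrow> ext_deriv 4 \<Psi> x v = 0"
    and geo: "normal_geodesic g \<gamma>"
    and nz: "\<forall>i\<in>{1..3}. \<forall>t\<in>{0<..<1}. A i t \<noteq> 0 \<and> B i t \<noteq> 0"
    and pb: "\<forall>t\<in>{0<..<1}. \<forall>a\<in>G. \<forall>v. (\<forall>i<3. snd (v i) \<in> tan_G a) \<longrightarrow>
           pullback (\<lambda>(s, b). act b (\<gamma> s)) \<phi> (t, a) v = phi_AB T A B (t, a) v"
    unfolding coclosed_def closed_form_def constructed_from_half_flat_def by blast
  note T = \<open>su2_basis T\<close>
  obtain I where I: "open I" "{0..1} \<subseteq> I" "smooth_on I \<gamma>" and S: "\<gamma> ` {0..1} \<subseteq> S3xS4"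
    and iso: "isotropy (\<gamma> 0) = Delta_SU2" "isotropy (\<gamma> 1) = Delta_SU2"
    using geo unfolding normal_geodesic_def geodesic_def by blast
  define \<gamma>' where "\<gamma>' t = vector_derivative \<gamma> (at t)" for t
  have \<gamma>': "(\<gamma> has_vector_derivative \<gamma>' t) (at t)" if "t \<in> {0..1}" for t
    unfolding \<gamma>'_def using smooth_on_differentiable[OF I(3)] I(2) that vector_derivative_works by blast
  \<comment> \<open>The curve is known to lie on the manifold for parameters in [0, 1] only, so an
    open parameter interval is available just for interior points.\<close>
  have tan: "\<gamma>' t \<in> tan_S3xS4 (\<gamma> t)" if "t \<in> {0<..<1}" for t
    using that S by (intro S3xS4_curve_tangent[OF \<gamma>', of t "{0<..<1}"]) auto
  have oneG: "(qone, qone) \<in> G"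
    by (simp add: G_iff qone_def)
  define f where "f i j s = \<Psi> (\<gamma> s) (tuple4 (fund_field (T_minus T i) (\<gamma> s)) (fund_field (T_minus T j) (\<gamma> s))
                         (fund_field (T_plus T i) (\<gamma> s)) (fund_field (T_plus T j) (\<gamma> s)))" for i j s
  have f_ends: "f i j 0 = 0" "f i j 1 = 0" if "i \<in> {1..3}" for i j
  proof -
    have "fund_field (T_plus T i) (\<gamma> 0) = 0" "fund_field (T_plus T i) (\<gamma> 1) = 0"
      unfolding T_plus_def using iso su2_basis_su2[OF T that] by (auto intro: isotropy_Delta_fund_field)
    moreover have x: "\<gamma> 0 \<in> S3xS4" "\<gamma> 1 \<in> S3xS4"
      using S by (auto simp: image_subset_iff)
    have "alt_form 4 (\<Psi> (\<gamma> 0))" "alt_form 4 (\<Psi> (\<gamma> 1))"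
      using ext x by (auto simp: extends_form_def)
    ultimately show "f i j 0 = 0" "f i j 1 = 0"
      using alt_form_tuple4(3)[THEN linear_0] by (simp_all add: f_def)
  qed
  have f_cont: "continuous_on {0..1} (f i j)" for i j
  proof (intro continuous_at_imp_continuous_on ballI)
    fix t :: real assume t: "t \<in> {0..1}"
    define u where "u = (\<lambda>n::nat. if n = 0 then T_minus T i else if n = 1 then T_minus T j
      else if n = 2 then T_plus T i else T_plus T j)"
    have x: "\<gamma> t \<in> S3xS4"
      using S t by blast
    have "f i j = (\<lambda>s. \<Psi> (\<gamma> s) (tuple4 (fund_field (u 0) (\<gamma> s)) (fund_field (u 1) (\<gamma> s)) (fund_field (u 2) (\<gamma> s)) (fund_field (u 3) (\<gamma> s))))"
      by (simp add: f_def u_def fun_eq_iff)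
    then show "isCont (f i j) t"
      \<comment> \<open>\<gamma> is smooth on an open set containing [0, 1], so this two-sided
        derivative exists at 0 and 1 too.\<close>
      using DERIV_isCont[OF fund_field_form_curve_derivative[OF ext \<gamma>'[OF t] x, of u]] by simp
  qed
  have val: "f 1 2 t = - 16 * (A 1 t * B 1 t * A 2 t * B 2 t)"
    "f 2 3 t = - 16 * (A 2 t * B 2 t * A 3 t * B 3 t)"
    "f 3 1 t = - 16 * (A 3 t * B 3 t * A 1 t * B 1 t)"
    and der: "(f 1 2 has_real_derivative
      - 16 * (A 1 t * A 2 t * A 3 t + A 1 t * B 2 t * B 3 t + A 2 t * B 3 t * B 1 t - A 3 t * B 1 t * B 2 t)) (at t)"
    "(f 2 3 has_real_derivative
      - 16 * (A 1 t * A 2 t * A 3 t + A 2 t * B 3 t * B 1 t + A 3 t * B 1 t * B 2 t - A 1 t * B 2 t * B 3 t)) (at t)"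
    "(f 3 1 has_real_derivative
      - 16 * (A 1 t * A 2 t * A 3 t + A 3 t * B 1 t * B 2 t + A 1 t * B 2 t * B 3 t - A 2 t * B 3 t * B 1 t)) (at t)"
    if t: "t \<in> {0<..<1}" for t
  proof -
    have t': "t \<in> {0..1}" and x: "\<gamma> t \<in> S3xS4"
      using t S by auto
    have nz': "\<forall>i\<in>{1..3}. A i t \<noteq> 0 \<and> B i t \<noteq> 0"
      using nz t by blast
    note H = hodge_star_half_flat_frame[where A = A and B = B and t = t,
        OF T nz' G2 star ext \<gamma>'[OF t'] x tan[OF t] bspec[OF bspec[OF pb t] oneG]]
    show "f 1 2 t = - 16 * (A 1 t * B 1 t * A 2 t * B 2 t)"
      "f 2 3 t = - 16 * (A 2 t * B 2 t * A 3 t * B 3 t)"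
      "f 3 1 t = - 16 * (A 3 t * B 3 t * A 1 t * B 1 t)"
      unfolding f_def by (rule H)+
    note D = coclosed_half_flat_derivative[OF T _ _ _ _ ext closed hodge_star_invariant[OF G2 inv star] \<gamma>'[OF t'] x tan[OF t]]
    have alt: "alt_form 4 (\<Psi> (\<gamma> t))"
      using x ext by (auto simp: extends_form_def)
    note sw = alt_form_tuple4_swap(2,3)[OF alt]
    let ?p = "\<lambda>i. fund_field (T_plus T i) (\<gamma> t)"
    \<comment> \<open>\<open>H\<close> evaluates the three plus fields in the order 1, 2, 3 only;
      cyclic reorderings are even.\<close>
    have rot: "\<Psi> (\<gamma> t) (tuple4 (\<gamma>' t) (?p 2) (?p 3) (?p 1)) = \<Psi> (\<gamma> t) (tuple4 (\<gamma>' t) (?p 1) (?p 2) (?p 3))"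
      "\<Psi> (\<gamma> t) (tuple4 (\<gamma>' t) (?p 3) (?p 1) (?p 2)) = \<Psi> (\<gamma> t) (tuple4 (\<gamma>' t) (?p 1) (?p 2) (?p 3))"
      using sw(1)[where a = "\<gamma>' t" and b = "?p 2" and c = "?p 1" and d = "?p 3"] sw(2)[where a = "\<gamma>' t" and b = "?p 2" and c = "?p 1" and d = "?p 3"]
        sw(1)[where a = "\<gamma>' t" and b = "?p 1" and c = "?p 3" and d = "?p 2"] sw(2)[where a = "\<gamma>' t" and b = "?p 1" and c = "?p 2" and d = "?p 3"]
      by linarith+
    show "(f 1 2 has_real_derivative
      - 16 * (A 1 t * A 2 t * A 3 t + A 1 t * B 2 t * B 3 t + A 2 t * B 3 t * B 1 t - A 3 t * B 1 t * B 2 t)) (at t)"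
      unfolding f_def[abs_def]
      using D[of 1 2 3, OF _ _ _ su2_basis_bracket(1)[OF T]] unfolding H rot
      by (rule DERIV_cong) simp_all
    show "(f 2 3 has_real_derivative
      - 16 * (A 1 t * A 2 t * A 3 t + A 2 t * B 3 t * B 1 t + A 3 t * B 1 t * B 2 t - A 1 t * B 2 t * B 3 t)) (at t)"
      unfolding f_def[abs_def]
      using D[of 2 3 1, OF _ _ _ su2_basis_bracket(2)[OF T]] unfolding H rot
      by (rule DERIV_cong) simp_all
    show "(f 3 1 has_real_derivative
      - 16 * (A 1 t * A 2 t * A 3 t + A 3 t * B 1 t * B 2 t + A 1 t * B 2 t * B 3 t - A 2 t * B 3 t * B 1 t)) (at t)"
      unfolding f_def[abs_def]
      using D[of 3 1 2, OF _ _ _ su2_basis_bracket(3)[OF T]] unfolding H rot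
      by (rule DERIV_cong) simp_all
  qed
  have sgn_const: "sgn (f i j t) = sgn (f i j (1/2))" if "t \<in> {0<..<1}" "(i, j) \<in> {(1, 2), (2, 3), (3, 1)}" for i j t
  proof (rule continuous_nonzero_sgn_constant[where S = "{0<..<1}" and f = "f i j" and x = t and y = "1/2"])
    show "continuous_on {0<..<1} (f i j)"
      using f_cont by (rule continuous_on_subset) auto
    show "f i j s \<noteq> 0" if "s \<in> {0<..<1}" for s
      using \<open>(i, j) \<in> _\<close> val[OF that] nz that by auto
  qed (use that in auto)
  \<comment> \<open>Sampling the signs at 1/2 makes them constants, so \<open>F\<close> can be
    differentiated term by term. At the Rolle point they are replaced by the signs there.\<close>
  define c where "c i j = sgn (f i j (1/2))" for i j
  define F where "F t = c 1 2 * f 1 2 t + c 2 3 * f 2 3 t + c 3 1 * f 3 1 t" for t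
  define F' where "F' t = c 1 2 * (- 16 * (A 1 t * A 2 t * A 3 t + A 1 t * B 2 t * B 3 t + A 2 t * B 3 t * B 1 t - A 3 t * B 1 t * B 2 t))
    + c 2 3 * (- 16 * (A 1 t * A 2 t * A 3 t + A 2 t * B 3 t * B 1 t + A 3 t * B 1 t * B 2 t - A 1 t * B 2 t * B 3 t))
    + c 3 1 * (- 16 * (A 1 t * A 2 t * A 3 t + A 3 t * B 1 t * B 2 t + A 1 t * B 2 t * B 3 t - A 2 t * B 3 t * B 1 t))" for t
  have "\<exists>t. 0 < t \<and> t < 1 \<and> (*) (F' t) = (\<lambda>_. 0)"
  proof (rule Rolle_deriv)
    show "F 0 = F 1"
      by (simp add: F_def f_ends)
    show "continuous_on {0..1} F"
      unfolding F_def by (intro continuous_intros f_cont)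
    show "(F has_derivative (*) (F' t)) (at t)" if "0 < t" "t < 1" for t
      using der[of t] that unfolding F_def[abs_def] F'_def has_field_derivative_def[symmetric]
      by (intro DERIV_add DERIV_cmult) auto
  qed simp
  then obtain t where t: "t \<in> {0<..<1}" and "F' t = 0"
    by (metis greaterThanLessThan_iff mult.right_neutral)
  have "c i j = sgn (f i j t)" if "(i, j) \<in> {(1, 2), (2, 3), (3, 1)}" for i j
    using sgn_const[OF t that] by (simp add: c_def)
  then have c: "c 1 2 = sgn (f 1 2 t)" "c 2 3 = sgn (f 2 3 t)" "c 3 1 = sgn (f 3 1 t)"
    by blast+
  \<comment> \<open>The minus signs come from the factor -16 in \<open>val\<close>; they cancel
    against the -16 in \<open>F'\<close>, leaving 16 times the sum in
    \<open>half_flat_sign_sum_nonzero\<close>.\<close>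
  have c': "c 1 2 = - sgn (A 1 t * B 1 t * A 2 t * B 2 t)" "c 2 3 = - sgn (A 2 t * B 2 t * A 3 t * B 3 t)"
    "c 3 1 = - sgn (A 3 t * B 3 t * A 1 t * B 1 t)"
    unfolding c val[OF t] by (simp_all add: sgn_mult)
  have "A 1 t \<noteq> 0" "A 2 t \<noteq> 0" "A 3 t \<noteq> 0" "B 1 t \<noteq> 0" "B 2 t \<noteq> 0" "B 3 t \<noteq> 0"
    using nz t by auto
  note half_flat_sign_sum_nonzero[OF this]
  moreover have "- r * (- 16 * x) + - s * (- 16 * y) + - q * (- 16 * z) = 16 * (r * x + s * y + q * z)"
    for r s q x y z :: real
    by simp
  ultimately show False
    using \<open>F' t = 0\<close> unfolding F'_def c' by (simp only: mult_eq_0_iff zero_neq_numeral simp_thms)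
qed

end
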